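(* The constant function $\chi\equiv 1$ on $[0,1]$ is a cyclic vector for $C_p$ for all $1<p<\infty$; that is, the closed linear span in $L^p(0,1)$ of $\{C_p^n\chi : n\ge 0\}$ is all of $L^p(0,1)$.
   Context: $L^p(0,1)$ is the space of complex-valued $p$-integrable functions on $(0,1)$ with Lebesgue measure. $C_p$ is the bounded operator on $L^p(0,1)$ given by $(C_pf)(x)=\frac1x\int_0^x\frac{f(t)}{1-t}\,dt$, $0<x<1$. A vector $f\in L^p(0,1)$ is a cyclic vector for $C_p$ if $\overline{\operatorname{span}}\{C_p^nf:n\ge0\}=L^p(0,1)$. *)

theory Defs
  imports "HOL-Analysis.Analysis" "HOL-Library.Function_Algebras"
begin

text \<open>
  An element of \<open>L\<^sup>p(0,1)\<close> is represented by a function on \<open>real\<close>; only its values on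
  \<open>(0,1)\<close> matter, and functions at seminorm distance 0 (equal almost everywhere on
  \<open>(0,1)\<close>) represent the same element.
\<close>

abbreviation unit_leb :: "real measure" where
  "unit_leb \<equiv> lebesgue_on {0<..<1}"

definition Lp :: "real \<Rightarrow> (real \<Rightarrow> complex) set" where
  "Lp p = {f. f \<in> borel_measurable unit_leb \<and>
              integrable unit_leb (\<lambda>x. norm (f x) powr p)}"

definition Lp_norm :: "real \<Rightarrow> (real \<Rightarrow> complex) \<Rightarrow> real" where
  "Lp_norm p f = (LINT x|unit_leb. norm (f x) powr p) powr (1 / p)"

text \<open>The approximants are required to lie in \<open>Lp p\<close>, since \<open>Lp_norm p\<close> is 0 on functions
  that are not \<open>p\<close>-integrable.\<close>

definition Lp_closure :: "real \<Rightarrow> (real \<Rightarrow> complex) set \<Rightarrow> (real \<Rightarrow> complex) set" where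
  "Lp_closure p S = {f \<in> Lp p. \<forall>\<epsilon>>0. \<exists>g \<in> S \<inter> Lp p. Lp_norm p (\<lambda>x. f x - g x) < \<epsilon>}"

text \<open>The library constant \<open>span\<close> is the real span; \<open>cfun.span\<close> is the span over \<open>complex\<close>.\<close>

global_interpretation cfun: vector_space "\<lambda>(c::complex) (f::real \<Rightarrow> complex) x. c * f x"
  by unfold_locales (auto simp: fun_eq_iff algebra_simps)

text \<open>The formula does not involve \<open>p\<close>, so one function serves as \<open>C\<^sub>p\<close> for every \<open>p\<close>.
  For \<open>f\<close> in \<open>Lp p\<close> and \<open>0 < x < 1\<close> the integral converges absolutely; the values at other
  \<open>x\<close> are irrelevant.\<close>

definition C_op :: "(real \<Rightarrow> complex) \<Rightarrow> real \<Rightarrow> complex" where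
  "C_op f x = 1 / of_real x * (LINT t:{0<..<x}|lebesgue. f t / of_real (1 - t))"

text \<open>The second conjunct holds whenever \<open>T\<close> maps \<open>Lp p\<close> into itself; it is stated because
  \<open>T\<close> ranges over all maps on functions.\<close>

definition cyclic_vector ::
  "real \<Rightarrow> ((real \<Rightarrow> complex) \<Rightarrow> (real \<Rightarrow> complex)) \<Rightarrow> (real \<Rightarrow> complex) \<Rightarrow> bool" where
  "cyclic_vector p T f \<longleftrightarrow>
     f \<in> Lp p \<and> (\<forall>n. (T ^^ n) f \<in> Lp p) \<and>
     Lp_closure p (cfun.span {(T ^^ n) f | n. True}) = Lp p"

end

theory Submission
  imports Defs
begin

text \<open>
  Write \<open>C\<close> for the operator and \<open>L = - ln t\<close>. The proof rests on the integral representation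
  \<open>(C\<^sup>m\<^sup>+\<^sup>1 1)(x) = \<integral>\<^sub>0\<^sup>1 (L\<^sup>m / m!) / (1 - x + x t) dt\<close> on \<open>(0,1)\<close> (\<open>funpow_C_op_one\<close>). Let
  \<open>K \<phi> (x) = \<integral>\<^sub>0\<^sup>1 \<phi>(t) / (1 - x + x t) dt\<close>. By Tonelli's theorem \<open>C (K \<phi>) = K \<psi>\<close> with
  \<open>\<psi>(r) = \<integral>\<^sub>r\<^sup>1 \<phi>(s) / s ds\<close>, and this step takes \<open>L\<^sup>m / m!\<close> to \<open>L\<^sup>m\<^sup>+\<^sup>1 / (m+1)!\<close>. Hence the closed
  span \<open>M\<close> of the orbit of 1 contains \<open>K q\<close> for every polynomial \<open>q\<close> in \<open>L\<close>.

  The set \<open>M\<close> is closed under pointwise limits that are dominated in \<open>L\<^sup>p\<close>. As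
  \<open>1 - x + x t\<close> is at least \<open>1 - x\<close> and at least \<open>t\<close>, a bound \<open>|\<phi>(t)| \<le> B t\<^sup>-\<^sup>a\<close> with \<open>a < 1/p\<close>
  gives an \<open>L\<^sup>p\<close> bound for \<open>K \<phi>\<close>. So \<open>\<phi>\<^sub>n \<rightarrow> \<phi>\<close> under such a bound carries \<open>K \<phi>\<^sub>n \<in> M\<close> over to
  \<open>K \<phi> \<in> M\<close> (\<open>kern_dominated_limit\<close>). Now \<open>t\<^sup>c = exp (- c L)\<close> is the sum of its exponential
  series, whose partial sums are bounded by \<open>t\<^sup>-\<^sup>c\<close>; for small \<open>c\<close> this puts \<open>K t\<^sup>c\<close> into \<open>M\<close>, and
  multiplying by \<open>t\<^sup>c\<close> again and again gives \<open>K t\<^sup>N\<^sup>c \<in> M\<close> for all \<open>N\<close>.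

  As \<open>N\<close> grows, \<open>t\<^sup>N\<^sup>c\<close> concentrates at \<open>t = 1\<close>. With \<open>u = 1 - t\<close> the kernel is
  \<open>1 / (1 - x u) = \<Sum>\<^sub>k\<^sub><\<^sub>n x\<^sup>k u\<^sup>k + x\<^sup>n u\<^sup>n / (1 - x u)\<close>. If \<open>x\<^sup>k \<in> M\<close> for \<open>k < n\<close>, subtract these terms
  from \<open>K t\<^sup>N\<^sup>c\<close> and divide by \<open>\<integral> t\<^sup>N\<^sup>c u\<^sup>n\<close>: the result tends to \<open>x\<^sup>n\<close> uniformly on \<open>(0,1)\<close>
  (\<open>kern_powr_expansion\<close>). So \<open>M\<close> contains all monomials, by Weierstrass all continuous
  functions, and by dominated limits all of \<open>L\<^sup>p\<close>.
\<close>

section \<open>Dominated limits in the closure of a subset of \<open>L\<^sup>p\<close>\<close>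

text \<open>
  In place of Minkowski's inequality: the factor \<open>2\<^sup>p\<close> is harmless, because only the closure
  matters and not the size of the norm.
\<close>

lemma norm_add_powr_le:
  fixes a b :: "'a::real_normed_vector"
  assumes "0 \<le> p"
  shows "norm (a + b) powr p \<le> 2 powr p * (norm a powr p + norm b powr p)"
proof -
  have "norm (a + b) powr p \<le> (2 * max (norm a) (norm b)) powr p"
    using norm_triangle_ineq[of a b] by (intro powr_mono2 assms) auto
  also have "\<dots> = 2 powr p * max (norm a) (norm b) powr p"
    by (simp add: powr_mult)
  also have "\<dots> \<le> 2 powr p * (norm a powr p + norm b powr p)"
    by (intro mult_left_mono) (auto simp: max_def)
  finally show ?thesis .
qed

lemma Lp_dominated:
  assumes "f \<in> borel_measurable unit_leb" "integrable unit_leb (\<lambda>x. G x powr p)"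
    and "AE x in unit_leb. norm (f x) \<le> G x" "0 \<le> p"
  shows "f \<in> Lp p"
proof -
  have "integrable unit_leb (\<lambda>x. norm (f x) powr p)"
  proof (rule Bochner_Integration.integrable_bound[OF assms(2)])
    show "(\<lambda>x. norm (f x) powr p) \<in> borel_measurable unit_leb"
      using assms(1) by measurable
    show "AE x in unit_leb. norm (norm (f x) powr p) \<le> norm (G x powr p)"
      using assms(3) by eventually_elim (auto intro!: powr_mono2 assms)
  qed
  then show ?thesis using assms by (auto simp: Lp_def)
qed

lemma Lp_add:
  assumes "f \<in> Lp p" "g \<in> Lp p" "0 \<le> p"
  shows "(\<lambda>x. f x + g x) \<in> Lp p"
proof -
  have "integrable unit_leb (\<lambda>x. 2 powr p * (norm (f x) powr p + norm (g x) powr p))"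
    using assms by (intro integrable_mult_right integrable_add) (auto simp: Lp_def)
  moreover have [measurable]: "f \<in> borel_measurable unit_leb" "g \<in> borel_measurable unit_leb"
    using assms by (auto simp: Lp_def)
  have "(\<lambda>x. norm (f x + g x) powr p) \<in> borel_measurable unit_leb"
    by measurable
  ultimately have "integrable unit_leb (\<lambda>x. norm (f x + g x) powr p)"
    by (rule Bochner_Integration.integrable_bound)
       (use norm_add_powr_le[OF assms(3)] in \<open>auto simp: abs_of_nonneg\<close>)
  with assms show ?thesis by (auto simp: Lp_def)
qed

lemma Lp_scale:
  assumes "f \<in> Lp p"
  shows "(\<lambda>x. c * f x) \<in> Lp p"
  using assms by (auto simp: Lp_def norm_mult powr_mult)

lemma Lp_diff:
  assumes "f \<in> Lp p" "g \<in> Lp p" "0 \<le> p"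
  shows "(\<lambda>x. f x - g x) \<in> Lp p"
  using Lp_add[OF assms(1) Lp_scale[OF assms(2), of "-1"] assms(3)] by simp

lemma Lp_norm_less_iff:
  assumes "0 < p" "0 < e"
  shows "Lp_norm p f < e \<longleftrightarrow> (LINT x|unit_leb. norm (f x) powr p) < e powr p"
proof -
  define I where "I = (LINT x|unit_leb. norm (f x) powr p)"
  have I: "0 \<le> I" unfolding I_def by (rule integral_nonneg_AE) auto
  have "I powr (1 / p) < e \<longleftrightarrow> I powr (1 / p) < (e powr p) powr (1 / p)"
    using assms by (simp add: powr_powr)
  also have "\<dots> \<longleftrightarrow> I < e powr p"
  proof
    assume "I powr (1 / p) < (e powr p) powr (1 / p)"
    then show "I < e powr p"
      using assms powr_mono2[of "1/p" "e powr p" I] by force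
  next
    assume "I < e powr p"
    then show "I powr (1 / p) < (e powr p) powr (1 / p)"
      using assms I by (intro powr_less_mono2) auto
  qed
  finally show ?thesis by (simp add: Lp_norm_def I_def)
qed

text \<open>
  The \<open>p\<close>-th root in the norm does not change which functions can be approximated. The
  integral of the \<open>p\<close>-th power is what convergence theorems speak about.
\<close>

lemma mem_Lp_closure_iff:
  assumes "0 < p"
  shows "f \<in> Lp_closure p S \<longleftrightarrow> f \<in> Lp p \<and>
    (\<forall>d>0. \<exists>g \<in> S \<inter> Lp p. (LINT x|unit_leb. norm (f x - g x) powr p) < d)"
proof -
  have "(\<forall>e>0. \<exists>g \<in> S \<inter> Lp p. Lp_norm p (\<lambda>x. f x - g x) < e) \<longleftrightarrow>
        (\<forall>d>0. \<exists>g \<in> S \<inter> Lp p. (LINT x|unit_leb. norm (f x - g x) powr p) < d)" (is "?L \<longleftrightarrow> ?R")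
  proof
    assume L: ?L
    show ?R
    proof (intro allI impI)
      fix d :: real assume d: "0 < d"
      then obtain g where "g \<in> S \<inter> Lp p" "Lp_norm p (\<lambda>x. f x - g x) < d powr (1/p)"
        using L[rule_format, of "d powr (1/p)"] by auto
      then show "\<exists>g \<in> S \<inter> Lp p. (LINT x|unit_leb. norm (f x - g x) powr p) < d"
        using assms d by (subst (asm) Lp_norm_less_iff) (auto simp: powr_powr)
    qed
  next
    assume R: ?R
    then show ?L using assms by (simp add: Lp_norm_less_iff)
  qed
  then show ?thesis by (simp add: Lp_closure_def)
qed

lemma Lp_distance_add_le:
  assumes "f \<in> Lp p" "g \<in> Lp p" "0 \<le> p"
  shows "(LINT x|unit_leb. norm (f x + g x) powr p) \<le>
    2 powr p * ((LINT x|unit_leb. norm (f x) powr p) + (LINT x|unit_leb. norm (g x) powr p))"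
proof -
  have "(LINT x|unit_leb. norm (f x + g x) powr p) \<le>
        (LINT x|unit_leb. 2 powr p * (norm (f x) powr p + norm (g x) powr p))"
  proof (rule integral_mono)
    show "integrable unit_leb (\<lambda>x. norm (f x + g x) powr p)"
      using Lp_add[OF assms] by (simp add: Lp_def)
    show "integrable unit_leb (\<lambda>x. 2 powr p * (norm (f x) powr p + norm (g x) powr p))"
      using assms by (intro integrable_mult_right integrable_add) (auto simp: Lp_def)
  qed (rule norm_add_powr_le[OF assms(3)])
  also have "\<dots> = 2 powr p * ((LINT x|unit_leb. norm (f x) powr p) + (LINT x|unit_leb. norm (g x) powr p))"
    using assms by (simp add: Lp_def)
  finally show ?thesis .
qed

lemma subset_Lp_closure: "S \<inter> Lp p \<subseteq> Lp_closure p S"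
  unfolding Lp_closure_def Lp_norm_def by (force intro: powr_less_mono2)

lemma Lp_closure_idem:
  assumes "0 < p"
  shows "Lp_closure p (Lp_closure p S) \<subseteq> Lp_closure p S"
proof
  fix f assume f: "f \<in> Lp_closure p (Lp_closure p S)"
  have "\<exists>h \<in> S \<inter> Lp p. (LINT x|unit_leb. norm (f x - h x) powr p) < d" if d: "d > 0" for d
  proof -
    define e where "e = d / (2 * 2 powr p)"
    have e: "e > 0" using d by (simp add: e_def)
    obtain g where g: "g \<in> Lp_closure p S" "(LINT x|unit_leb. norm (f x - g x) powr p) < e"
      using f e unfolding mem_Lp_closure_iff[OF assms, of f] by blast
    obtain h where h: "h \<in> S \<inter> Lp p" "(LINT x|unit_leb. norm (g x - h x) powr p) < e"
      using g e unfolding mem_Lp_closure_iff[OF assms, of g] by blast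
    have "f \<in> Lp p" "g \<in> Lp p" "h \<in> Lp p" using f g h by (auto simp: Lp_closure_def)
    then have "(LINT x|unit_leb. norm ((f x - g x) + (g x - h x)) powr p) \<le>
      2 powr p * ((LINT x|unit_leb. norm (f x - g x) powr p) + (LINT x|unit_leb. norm (g x - h x) powr p))"
      using assms by (intro Lp_distance_add_le Lp_diff) auto
    also have "\<dots> < 2 powr p * (e + e)"
      using g h by (intro mult_strict_left_mono add_strict_mono) auto
    also have "\<dots> = d" by (simp add: e_def)
    finally show ?thesis using h by auto
  qed
  with f show "f \<in> Lp_closure p S"
    by (subst mem_Lp_closure_iff[OF assms]) (auto simp: Lp_closure_def)
qed

text \<open>
  All approximations below are limits of this kind. Dominated convergence puts \<open>g\<close> into the
  closure of the closure, which is the closure.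
\<close>

lemma Lp_closure_dominated_limit:
  assumes p: "0 < p"
    and fn: "\<And>n. f n \<in> Lp_closure p S"
    and G: "integrable unit_leb (\<lambda>x. G x powr p)"
    and bound: "\<And>n. AE x in unit_leb. norm (f n x) \<le> G x"
    and lim: "AE x in unit_leb. (\<lambda>n. f n x) \<longlonglongrightarrow> g x"
    and g: "g \<in> borel_measurable unit_leb"
  shows "g \<in> Lp_closure p S"
proof -
  have fm: "f n \<in> borel_measurable unit_leb" for n
    using fn[of n] by (auto simp: Lp_closure_def Lp_def)
  have allb: "AE x in unit_leb. \<forall>n. norm (f n x) \<le> G x"
    using bound by (simp add: AE_all_countable)
  have gb: "AE x in unit_leb. norm (g x) \<le> G x"
    using allb lim
  proof eventually_elim
    case (elim x)
    then show ?case by (intro tendsto_upperbound[OF tendsto_norm[OF elim(2)]]) auto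
  qed
  have gL: "g \<in> Lp p" using p by (intro Lp_dominated[OF g G gb]) auto
  have lim0: "(\<lambda>n. LINT x|unit_leb. norm (g x - f n x) powr p) \<longlonglongrightarrow> (LINT x|unit_leb. 0)"
  proof (rule integral_dominated_convergence[where w = "\<lambda>x. 2 powr p * G x powr p"])
    show "integrable unit_leb (\<lambda>x. 2 powr p * G x powr p)" using G by simp
    show "(\<lambda>x. norm (g x - f n x) powr p) \<in> borel_measurable unit_leb" for n
      using g fm[of n] by measurable
    show "AE x in unit_leb. (\<lambda>n. norm (g x - f n x) powr p) \<longlonglongrightarrow> 0"
      using lim
    proof eventually_elim
      case (elim x)
      have "(\<lambda>n. norm (g x - f n x)) \<longlonglongrightarrow> norm (g x - g x)"
        using elim by (intro tendsto_intros)
      then have "(\<lambda>n. norm (g x - f n x)) \<longlonglongrightarrow> 0" by simp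
      from tendsto_powr'[OF this tendsto_const, of p] show ?case using p by simp
    qed
    show "AE x in unit_leb. norm (norm (g x - f n x) powr p) \<le> 2 powr p * G x powr p" for n
      using bound[of n] gb
    proof eventually_elim
      case (elim x)
      have "norm (g x - f n x) \<le> 2 * G x"
        using elim norm_triangle_ineq4[of "g x" "f n x"] by linarith
      then have "norm (g x - f n x) powr p \<le> (2 * G x) powr p"
        using p by (intro powr_mono2) auto
      also have "\<dots> = 2 powr p * G x powr p"
        using elim norm_ge_zero[of "g x"] by (intro powr_mult)
      finally show ?case by simp
    qed
  qed auto
  have "g \<in> Lp_closure p (Lp_closure p S)"
    unfolding mem_Lp_closure_iff[OF p, of g]
  proof (intro conjI gL allI impI)
    fix d :: real assume d: "0 < d"
    have "\<forall>\<^sub>F n in sequentially. (LINT x|unit_leb. norm (g x - f n x) powr p) < d"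
      using order_tendstoD(2)[OF lim0] d by simp
    then obtain n where "(LINT x|unit_leb. norm (g x - f n x) powr p) < d"
      by (auto dest: eventually_happens)
    moreover have "f n \<in> Lp_closure p S \<inter> Lp p" using fn[of n] by (auto simp: Lp_closure_def)
    ultimately show "\<exists>h\<in>Lp_closure p S \<inter> Lp p. (LINT x|unit_leb. norm (g x - h x) powr p) < d"
      by blast
  qed
  then show ?thesis using Lp_closure_idem[OF p] by blast
qed

lemma Lp_closure_add:
  assumes p: "0 < p" and S: "\<And>f g. f \<in> S \<Longrightarrow> g \<in> S \<Longrightarrow> (\<lambda>x. f x + g x) \<in> S"
    and fg: "f \<in> Lp_closure p S" "g \<in> Lp_closure p S"
  shows "(\<lambda>x. f x + g x) \<in> Lp_closure p S"
  unfolding mem_Lp_closure_iff[OF p, of "\<lambda>x. f x + g x"]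
proof (intro conjI allI impI)
  have L: "f \<in> Lp p" "g \<in> Lp p" using fg by (auto simp: Lp_closure_def)
  then show "(\<lambda>x. f x + g x) \<in> Lp p" using p by (intro Lp_add) auto
  fix d :: real assume d: "0 < d"
  define e where "e = d / (2 * 2 powr p)"
  have e: "e > 0" using d by (simp add: e_def)
  obtain f' where f': "f' \<in> S \<inter> Lp p" "(LINT x|unit_leb. norm (f x - f' x) powr p) < e"
    using fg e unfolding mem_Lp_closure_iff[OF p] by blast
  obtain g' where g': "g' \<in> S \<inter> Lp p" "(LINT x|unit_leb. norm (g x - g' x) powr p) < e"
    using fg e unfolding mem_Lp_closure_iff[OF p] by blast
  have "(LINT x|unit_leb. norm ((f x - f' x) + (g x - g' x)) powr p) \<le>
    2 powr p * ((LINT x|unit_leb. norm (f x - f' x) powr p) + (LINT x|unit_leb. norm (g x - g' x) powr p))"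
    using p L f' g' by (intro Lp_distance_add_le Lp_diff) auto
  also have "\<dots> < 2 powr p * (e + e)"
    using f' g' by (intro mult_strict_left_mono add_strict_mono) auto
  also have "\<dots> = d" by (simp add: e_def)
  finally have "(LINT x|unit_leb. norm ((f x + g x) - (f' x + g' x)) powr p) < d"
    by (simp add: algebra_simps)
  moreover have "(\<lambda>x. f' x + g' x) \<in> S \<inter> Lp p"
    using f' g' S p by (auto intro: Lp_add)
  ultimately show "\<exists>h\<in>S \<inter> Lp p. (LINT x|unit_leb. norm ((f x + g x) - h x) powr p) < d"
    by (intro bexI[where x = "\<lambda>x. f' x + g' x"])
qed

lemma Lp_closure_scale:
  assumes p: "0 < p" and S: "\<And>f. f \<in> S \<Longrightarrow> (\<lambda>x. c * f x) \<in> S"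
    and f: "f \<in> Lp_closure p S"
  shows "(\<lambda>x. c * f x) \<in> Lp_closure p S"
  unfolding mem_Lp_closure_iff[OF p, of "\<lambda>x. c * f x"]
proof (intro conjI allI impI)
  show "(\<lambda>x. c * f x) \<in> Lp p" using f by (intro Lp_scale) (auto simp: Lp_closure_def)
  fix d :: real assume d: "0 < d"
  define e where "e = d / (norm c powr p + 1)"
  have c1: "norm c powr p + 1 > 0" using powr_ge_zero[of "norm c" p] by linarith
  have e: "e > 0" using d c1 by (simp add: e_def)
  obtain g where g: "g \<in> S \<inter> Lp p" "(LINT x|unit_leb. norm (f x - g x) powr p) < e"
    using f e unfolding mem_Lp_closure_iff[OF p] by blast
  have "(LINT x|unit_leb. norm (c * f x - c * g x) powr p) =
        norm c powr p * (LINT x|unit_leb. norm (f x - g x) powr p)"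
    by (simp add: norm_mult powr_mult flip: right_diff_distrib)
  also have "\<dots> \<le> norm c powr p * e"
    using g by (intro mult_left_mono) auto
  also have "\<dots> < (norm c powr p + 1) * e"
    using e by (intro mult_strict_right_mono) auto
  also have "\<dots> = d" using c1 by (simp add: e_def)
  finally have "(LINT x|unit_leb. norm (c * f x - c * g x) powr p) < d" .
  moreover have "(\<lambda>x. c * g x) \<in> S \<inter> Lp p" using g S by (auto intro: Lp_scale)
  ultimately show "\<exists>h\<in>S \<inter> Lp p. (LINT x|unit_leb. norm (c * f x - h x) powr p) < d"
    by (intro bexI[where x = "\<lambda>x. c * g x"])
qed

lemma AE_unit_leb_I:
  assumes "\<And>x. 0 < x \<Longrightarrow> x < 1 \<Longrightarrow> P x"
  shows "AE x in unit_leb. P x"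
  using assms by (intro AE_I2) auto

lemma Lp_cong:
  assumes "\<And>x. 0 < x \<Longrightarrow> x < 1 \<Longrightarrow> f x = g x"
  shows "f \<in> Lp p \<longleftrightarrow> g \<in> Lp p"
proof -
  have "f \<in> borel_measurable unit_leb \<longleftrightarrow> g \<in> borel_measurable unit_leb"
    using assms by (intro measurable_cong) auto
  moreover have "integrable unit_leb (\<lambda>x. norm (f x) powr p) \<longleftrightarrow> integrable unit_leb (\<lambda>x. norm (g x) powr p)"
    using assms by (intro Bochner_Integration.integrable_cong) auto
  ultimately show ?thesis by (simp add: Lp_def)
qed

lemma Lp_closure_cong:
  assumes p: "0 < p" and f: "f \<in> Lp_closure p S" and fg: "\<And>x. 0 < x \<Longrightarrow> x < 1 \<Longrightarrow> f x = g x"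
  shows "g \<in> Lp_closure p S"
proof (rule Lp_closure_dominated_limit[where f = "\<lambda>_. f" and G = "\<lambda>x. norm (f x)"])
  have "f \<in> Lp p" using f by (auto simp: Lp_closure_def)
  then show "integrable unit_leb (\<lambda>x. norm (f x) powr p)" by (simp add: Lp_def)
  have "g \<in> Lp p" using \<open>f \<in> Lp p\<close> Lp_cong[of f g p] fg by auto
  then show "g \<in> borel_measurable unit_leb" by (simp add: Lp_def)
  show "AE x in unit_leb. (\<lambda>n. f x) \<longlonglongrightarrow> g x"
    by (rule AE_unit_leb_I) (simp add: fg)
qed (use p f in auto)

lemma borel_measurable_unit_leb_of_real:
  assumes "g \<in> borel_measurable borel"
  shows "(\<lambda>x. complex_of_real (g x)) \<in> borel_measurable unit_leb"
proof -
  have "(\<lambda>x. complex_of_real (g x)) \<in> borel_measurable lborel"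
    using assms by measurable
  then have "(\<lambda>x. complex_of_real (g x)) \<in> borel_measurable lebesgue"
    by (rule measurable_completion)
  then show ?thesis by (rule measurable_restrict_space1)
qed

section \<open>Integrals over the unit interval\<close>

lemma nn_integral_FTC_Ioo:
  fixes f F :: "real \<Rightarrow> real"
  assumes "f \<in> borel_measurable borel" "a \<le> b"
    and "\<And>x. a \<le> x \<Longrightarrow> x \<le> b \<Longrightarrow> (F has_real_derivative f x) (at x)"
    and "\<And>x. a \<le> x \<Longrightarrow> x \<le> b \<Longrightarrow> 0 \<le> f x"
  shows "(\<integral>\<^sup>+x\<in>{a<..<b}. ennreal (f x) \<partial>lborel) = ennreal (F b - F a)"
proof -
  have "(\<integral>\<^sup>+x\<in>{a<..<b}. ennreal (f x) \<partial>lborel) = (\<integral>\<^sup>+x\<in>{a..b}. ennreal (f x) \<partial>lborel)"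
  proof (rule nn_integral_cong_AE)
    show "AE x in lborel. ennreal (f x) * indicator {a<..<b} x = ennreal (f x) * indicator {a..b} x"
      using AE_lborel_singleton[of a] AE_lborel_singleton[of b]
      by eventually_elim (auto split: split_indicator)
  qed
  also have "\<dots> = ennreal (F b - F a)"
    using assms by (intro nn_integral_FTC_Icc) auto
  finally show ?thesis .
qed

lemma set_integrable_powr_01:
  fixes c :: real
  assumes "-1 < c"
  shows "set_integrable lborel {0<..<1} (\<lambda>t. t powr c)"
    and "(LBINT t:{0<..<1}. t powr c) = 1 / (c + 1)"
proof -
  have h: "((\<lambda>x. x powr c) has_integral 1 / (c + 1)) {0<..<1}"
    using has_integral_powr_from_0[OF assms, of 1] by (simp add: has_integral_Icc_iff_Ioo)
  then have "set_integrable lebesgue {0<..<1} (\<lambda>t. t powr c)"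
    by (intro nonnegative_absolutely_integrable_1) auto
  then show i: "set_integrable lborel {0<..<1} (\<lambda>t. t powr c)"
    unfolding set_integrable_def by (subst (asm) integrable_completion) auto
  show "(LBINT t:{0<..<1}. t powr c) = 1 / (c + 1)"
    using set_borel_integral_eq_integral(2)[OF i] h by (simp add: integral_unique)
qed

lemma integrable_unit_leb_reflected_powr:
  assumes "c < 1"
  shows "integrable unit_leb (\<lambda>x. (1 - x) powr (- c))"
proof -
  have "integrable lborel (\<lambda>t. indicator {0<..<1} t *\<^sub>R t powr (- c))"
    using set_integrable_powr_01(1)[of "- c"] assms by (simp add: set_integrable_def)
  then have "integrable lborel (\<lambda>x. indicator {0<..<1} (1 + (- 1) * x) *\<^sub>R (1 + (- 1) * x) powr (- c))"
    by (rule lborel_integrable_real_affine) auto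
  also have "(\<lambda>x. indicator {0<..<1} (1 + (- 1) * x) *\<^sub>R (1 + (- 1) * x) powr (- c)) =
    (\<lambda>x::real. indicator {0<..<1} x *\<^sub>R (1 - x) powr (- c))"
    by (auto simp: fun_eq_iff split: split_indicator)
  finally have "integrable lebesgue (\<lambda>x. indicator {0<..<1} x *\<^sub>R (1 - x) powr (- c))"
    by (subst integrable_completion) auto
  then show ?thesis by (simp add: integrable_restrict_space)
qed

lemma set_integral_finite_sum:
  fixes f :: "'i \<Rightarrow> real \<Rightarrow> real"
  assumes "\<And>i. i \<in> I \<Longrightarrow> set_integrable M A (f i)"
  shows "set_integrable M A (\<lambda>x. \<Sum>i\<in>I. f i x)"
    and "(LINT x:A|M. \<Sum>i\<in>I. f i x) = (\<Sum>i\<in>I. LINT x:A|M. f i x)"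
  using assms unfolding set_integrable_def set_lebesgue_integral_def
  by (simp_all only: scaleR_sum_right)
     (auto intro!: Bochner_Integration.integrable_sum Bochner_Integration.integral_sum simp del: real_scaleR_def)

section \<open>The integral operator and its \<open>L\<^sup>p\<close> bounds\<close>

text \<open>
  The operator \<open>K\<close> of the introduction. For \<open>\<phi>(t) = t\<^sup>\<alpha>\<close> it is formally the resolvent expression
  \<open>C (1 + \<alpha> C)\<^sup>-\<^sup>1 1\<close>.
\<close>

definition kern :: "(real \<Rightarrow> real) \<Rightarrow> real \<Rightarrow> real" where
  "kern \<phi> x = (LBINT t:{0<..<1}. \<phi> t / (1 - x + x * t))"

lemma kern_denominator_pos:
  fixes x t :: real
  assumes "0 < x" "x < 1" "0 \<le> t"
  shows "0 < 1 - x + x * t"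
  using mult_nonneg_nonneg[of x t] assms by linarith

text \<open>
  The denominator is at least \<open>1 - x\<close> and at least \<open>t\<close>, hence at least every weighted geometric
  mean of the two. The
  exponent \<open>b\<close> divides the singularity of the kernel at \<open>x = 1, t = 0\<close> between \<open>x\<close> and \<open>t\<close>.
\<close>

lemma kern_denominator_ge:
  fixes x t b :: real
  assumes "0 < x" "x < 1" "0 < t" "t < 1" "0 \<le> b" "b \<le> 1"
  shows "(1 - x) powr b * t powr (1 - b) \<le> 1 - x + x * t"
proof -
  have d: "1 - x \<le> 1 - x + x * t" using assms by simp
  have "0 \<le> (1 - x) * (1 - t)" using assms by simp
  then have t: "t \<le> 1 - x + x * t" by (simp add: algebra_simps)
  have "(1 - x) powr b * t powr (1 - b) \<le> (1 - x + x * t) powr b * (1 - x + x * t) powr (1 - b)"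
    using assms d t by (intro mult_mono powr_mono2) auto
  also have "\<dots> = 1 - x + x * t"
    using kern_denominator_pos[of x t] assms by (simp flip: powr_add)
  finally show ?thesis .
qed

lemma kern_integrand_bound:
  fixes x t b :: real
  assumes "\<bar>\<phi> t\<bar> \<le> B * t powr (- a)" "0 \<le> b" "b \<le> 1" "0 < x" "x < 1" "0 < t" "t < 1"
  shows "\<bar>\<phi> t / (1 - x + x * t)\<bar> \<le> B * (1 - x) powr (- b) * t powr (b - a - 1)"
proof -
  have "\<bar>\<phi> t / (1 - x + x * t)\<bar> = \<bar>\<phi> t\<bar> / (1 - x + x * t)"
    using kern_denominator_pos[of x t] assms by simp
  also have "\<dots> \<le> B * t powr (- a) / ((1 - x) powr b * t powr (1 - b))"
    using assms kern_denominator_ge[of x t b] by (intro frac_le) (auto intro: order_trans[OF abs_ge_zero])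
  also have "\<dots> = B * (1 - x) powr (- b) * (t powr (- a) * t powr (- (1 - b)))"
    by (simp only: powr_minus) (simp add: field_simps)
  also have "t powr (- a) * t powr (- (1 - b)) = t powr (b - a - 1)"
    using assms by (simp flip: powr_add add: algebra_simps)
  finally show ?thesis .
qed

lemma kern_integrable:
  fixes \<phi> :: "real \<Rightarrow> real" and x :: real
  assumes [measurable]: "\<phi> \<in> borel_measurable borel"
    and "\<And>t. 0 < t \<Longrightarrow> t < 1 \<Longrightarrow> \<bar>\<phi> t\<bar> \<le> B * t powr (- a)" "a < 1" "0 < x" "x < 1"
  shows "set_integrable lborel {0<..<1} (\<lambda>t. \<phi> t / (1 - x + x * t))"
proof -
  have "set_integrable lborel {0<..<1} (\<lambda>t. B * (1 - x) powr (- 1) * t powr (1 - a - 1))"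
    by (rule set_integrable_mult_right, rule set_integrable_powr_01) (use \<open>a < 1\<close> in auto)
  then show ?thesis
  proof (rule set_integrable_bound)
    show "set_borel_measurable lborel {0<..<1} (\<lambda>t. \<phi> t / (1 - x + x * t))"
      unfolding set_borel_measurable_def by measurable
    show "AE t\<in>{0<..<1} in lborel. norm (\<phi> t / (1 - x + x * t)) \<le> norm (B * (1 - x) powr (- 1) * t powr (1 - a - 1))"
      using kern_integrand_bound[of \<phi> _ B a 1 x] assms(2,4,5)
      by (intro AE_I2) (fastforce intro: order_trans[OF _ abs_ge_self])
  qed
qed

lemma kern_bound:
  fixes \<phi> :: "real \<Rightarrow> real" and x :: real
  assumes [measurable]: "\<phi> \<in> borel_measurable borel"
    and "\<And>t. 0 < t \<Longrightarrow> t < 1 \<Longrightarrow> \<bar>\<phi> t\<bar> \<le> B * t powr (- a)" "a < b" "0 \<le> b" "b \<le> 1" "0 < x" "x < 1"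
  shows "\<bar>kern \<phi> x\<bar> \<le> B / (b - a) * (1 - x) powr (- b)"
proof -
  have "norm (kern \<phi> x) \<le> (LBINT t:{0<..<1}. norm (\<phi> t / (1 - x + x * t)))"
    unfolding kern_def using assms
    by (intro set_integral_norm_bound kern_integrable[of \<phi> B a]) auto
  also have "\<dots> \<le> (LBINT t:{0<..<1}. B * (1 - x) powr (- b) * t powr (b - a - 1))"
  proof (rule set_integral_mono)
    show "set_integrable lborel {0<..<1} (\<lambda>t. norm (\<phi> t / (1 - x + x * t)))"
      using assms by (intro set_integrable_norm kern_integrable[of \<phi> B a]) auto
    show "set_integrable lborel {0<..<1} (\<lambda>t. B * (1 - x) powr (- b) * t powr (b - a - 1))"
      by (rule set_integrable_mult_right, rule set_integrable_powr_01) (use \<open>a < b\<close> in auto)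
  qed (use kern_integrand_bound[of \<phi> _ B a b x] assms in auto)
  also have "\<dots> = B / (b - a) * (1 - x) powr (- b)"
    using assms by (simp add: set_integrable_powr_01)
  finally show ?thesis by simp
qed

lemma kern_borel_measurable [measurable]:
  assumes [measurable]: "\<phi> \<in> borel_measurable borel"
  shows "kern \<phi> \<in> borel_measurable borel"
  unfolding kern_def set_lebesgue_integral_def by measurable

lemma kern_cong:
  assumes "\<And>t. 0 < t \<Longrightarrow> t < 1 \<Longrightarrow> \<phi> t = \<psi> t"
  shows "kern \<phi> x = kern \<psi> x"
  unfolding kern_def by (intro set_lebesgue_integral_cong) (auto simp: assms)

lemma kern_lincomb:
  fixes c :: "'i \<Rightarrow> real" and \<phi> :: "'i \<Rightarrow> real \<Rightarrow> real"
  assumes "\<And>i. i \<in> I \<Longrightarrow> \<phi> i \<in> borel_measurable borel"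
    and "\<And>i t. i \<in> I \<Longrightarrow> 0 < t \<Longrightarrow> t < 1 \<Longrightarrow> \<bar>\<phi> i t\<bar> \<le> B i * t powr (- a)"
    and "a < 1" "0 < x" "x < 1"
  shows "kern (\<lambda>t. \<Sum>i\<in>I. c i * \<phi> i t) x = (\<Sum>i\<in>I. c i * kern (\<phi> i) x)"
proof -
  have "kern (\<lambda>t. \<Sum>i\<in>I. c i * \<phi> i t) x =
      (LBINT t:{0<..<1}. \<Sum>i\<in>I. c i * (\<phi> i t / (1 - x + x * t)))"
    by (simp add: kern_def sum_divide_distrib)
  also have "\<dots> = (\<Sum>i\<in>I. LBINT t:{0<..<1}. c i * (\<phi> i t / (1 - x + x * t)))"
    using assms by (intro set_integral_finite_sum set_integrable_mult_right kern_integrable[of "\<phi> _" "B _" a x]) auto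
  finally show ?thesis by (simp only: kern_def set_integral_mult_right)
qed

text \<open>
  One function \<open>G\<close> serves all \<open>\<phi>\<close> with the same \<open>B\<close> and \<open>a\<close>, as dominated convergence demands.
\<close>

lemma kern_Lp_dominator:
  fixes p a B :: real
  assumes p: "1 < p" and a: "0 \<le> a" "a < 1 / p"
  obtains G where "integrable unit_leb (\<lambda>x. G x powr p)"
    and "\<And>\<phi> x. \<phi> \<in> borel_measurable borel \<Longrightarrow>
          (\<And>t. 0 < t \<Longrightarrow> t < 1 \<Longrightarrow> \<bar>\<phi> t\<bar> \<le> B * t powr (- a)) \<Longrightarrow> 0 < x \<Longrightarrow> x < 1 \<Longrightarrow>
          \<bar>kern \<phi> x\<bar> \<le> G x"
proof
  \<comment> \<open>\<open>a < b\<close> makes the integral over \<open>t\<close> finite, and \<open>b p < 1\<close> makes \<open>(1 - x)\<^sup>-\<^sup>b\<^sup>p\<close> integrable.\<close>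
  define b where "b = (a + 1 / p) / 2"
  have b: "a < b" "b * p < 1" "b < 1 / p"
    using a p by (auto simp: b_def field_simps)
  have b1: "b \<le> 1" using b(3) p by (smt (verit) divide_less_eq_1_pos)
  let ?G = "\<lambda>x. B / (b - a) * (1 - x) powr (- b)"
  have "integrable unit_leb (\<lambda>x. (B / (b - a)) powr p * (1 - x) powr (- (b * p)))"
    using b by (intro integrable_mult_right integrable_unit_leb_reflected_powr)
  then show "integrable unit_leb (\<lambda>x. ?G x powr p)"
    by (simp only: powr_mult powr_powr mult_minus_left)
  show "\<bar>kern \<phi> x\<bar> \<le> ?G x" if "\<phi> \<in> borel_measurable borel"
     "\<And>t. 0 < t \<Longrightarrow> t < 1 \<Longrightarrow> \<bar>\<phi> t\<bar> \<le> B * t powr (- a)" "0 < x" "x < 1" for \<phi> x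
    using kern_bound[of \<phi> B a b x] that b b1 a by auto
qed

lemma kern_in_Lp:
  fixes p a B :: real
  assumes "1 < p" "0 \<le> a" "a < 1 / p" "\<phi> \<in> borel_measurable borel"
    and "\<And>t. 0 < t \<Longrightarrow> t < 1 \<Longrightarrow> \<bar>\<phi> t\<bar> \<le> B * t powr (- a)"
  shows "(\<lambda>x. complex_of_real (kern \<phi> x)) \<in> Lp p"
proof -
  obtain G where G: "integrable unit_leb (\<lambda>x. G x powr p)"
    "\<And>\<phi> x. \<phi> \<in> borel_measurable borel \<Longrightarrow>
          (\<And>t. 0 < t \<Longrightarrow> t < 1 \<Longrightarrow> \<bar>\<phi> t\<bar> \<le> B * t powr (- a)) \<Longrightarrow> 0 < x \<Longrightarrow> x < 1 \<Longrightarrow>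
          \<bar>kern \<phi> x\<bar> \<le> G x"
    using kern_Lp_dominator[of p a B] assms by metis
  show ?thesis
  proof (rule Lp_dominated[OF _ G(1)])
    show "(\<lambda>x. complex_of_real (kern \<phi> x)) \<in> borel_measurable unit_leb"
      using assms by (intro borel_measurable_unit_leb_of_real kern_borel_measurable)
  qed (use assms G(2)[of \<phi>] in \<open>auto intro!: AE_unit_leb_I\<close>)
qed

section \<open>The orbit of the constant function\<close>

lemma power_div_fact_le_exp:
  assumes "0 \<le> (y::real)"
  shows "y ^ m / fact m \<le> exp y"
proof -
  have "(\<Sum>n\<in>{m}. y ^ n /\<^sub>R fact n) \<le> (\<Sum>n. y ^ n /\<^sub>R fact n)"
    using assms by (intro sum_le_suminf summable_exp_generic) auto
  then show ?thesis by (simp add: exp_def divide_inverse mult.commute)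
qed

text \<open>
  A power of \<open>- ln t\<close> costs only an arbitrarily small negative power of \<open>t\<close>: compare one term of
  the exponential series at \<open>- d ln t\<close> with its sum.
\<close>

lemma neg_ln_power_le:
  assumes "0 < t" "t < 1" "0 < (d::real)"
  shows "(- ln t) ^ m \<le> fact m / d ^ m * t powr (- d)"
proof -
  have "(d * (- ln t)) ^ m / fact m \<le> exp (d * (- ln t))"
    using assms by (intro power_div_fact_le_exp mult_nonneg_nonneg) auto
  also have "\<dots> = t powr (- d)" using assms by (simp add: powr_def)
  finally have "d ^ m * (- ln t) ^ m \<le> fact m * t powr (- d)"
    by (simp add: power_mult_distrib field_simps flip: power_mult_distrib)
  then show ?thesis using assms by (simp add: field_simps)
qed

definition log_weight :: "nat \<Rightarrow> real \<Rightarrow> real" where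
  "log_weight m t = (- ln t) ^ m / fact m"

lemma log_weight_measurable [measurable]: "log_weight m \<in> borel_measurable borel"
  unfolding log_weight_def by measurable

lemma log_weight_nonneg: "0 < t \<Longrightarrow> t \<le> 1 \<Longrightarrow> 0 \<le> log_weight m t"
  by (simp add: log_weight_def)

lemma log_weight_bound:
  assumes "0 < t" "t < 1" "0 < d"
  shows "\<bar>log_weight m t\<bar> \<le> 1 / d ^ m * t powr (- d)"
proof -
  have "\<bar>log_weight m t\<bar> = log_weight m t"
    using assms by (simp add: log_weight_nonneg)
  then show ?thesis
    using neg_ln_power_le[OF assms, of m] assms by (simp add: log_weight_def field_simps)
qed

text \<open>
  The recursion \<open>\<psi>(r) = \<integral>\<^sub>r\<^sup>1 \<phi>(s) / s ds\<close> that \<open>C\<close> induces on densities.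
\<close>

lemma nn_integral_log_weight:
  assumes "0 < r" "r < 1"
  shows "(\<integral>\<^sup>+s\<in>{r<..<1}. ennreal (log_weight m s / s) \<partial>lborel) = ennreal (log_weight (Suc m) r)"
proof -
  have "(\<integral>\<^sup>+s\<in>{r<..<1}. ennreal (log_weight m s / s) \<partial>lborel) =
      ennreal (- log_weight (Suc m) 1 - (- log_weight (Suc m) r))"
  proof (rule nn_integral_FTC_Ioo)
    fix s assume s: "r \<le> s" "s \<le> 1"
    have "((\<lambda>s. - log_weight (Suc m) s) has_real_derivative
        - (real (Suc m) * (- ln s) ^ m * (- (1 / s)) / fact (Suc m))) (at s)"
      unfolding log_weight_def using s assms
      by (auto intro!: derivative_eq_intros simp del: power_Suc fact_Suc)
    also have "- (real (Suc m) * (- ln s) ^ m * (- (1 / s)) / fact (Suc m)) = log_weight m s / s"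
      by (simp add: log_weight_def divide_simps del: of_nat_Suc)
    finally show "((\<lambda>s. - log_weight (Suc m) s) has_real_derivative log_weight m s / s) (at s)" .
    show "0 \<le> log_weight m s / s" using s assms by (simp add: log_weight_nonneg)
  qed (use assms in auto)
  then show ?thesis by (simp add: log_weight_def)
qed

text \<open>
  By partial fractions. Together with \<open>nn_integral_kern_in_t\<close> it shows that the kernel, integrated
  over \<open>y\<close> with the weight \<open>1 / (1 - y)\<close>, and the kernel integrated over \<open>r\<close>, lead to the same
  logarithm.
\<close>

lemma nn_integral_kern_in_x:
  assumes "0 < x" "x < 1" "0 < t" "t < 1"
  shows "(\<integral>\<^sup>+y\<in>{0<..<x}. ennreal (1 / ((1 - y) * (1 - y + y * t))) \<partial>lborel) =
    ennreal (ln ((1 - x + x * t) / (1 - x)) / t)"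
proof -
  have "(\<integral>\<^sup>+y\<in>{0<..<x}. ennreal (1 / ((1 - y) * (1 - y + y * t))) \<partial>lborel) =
    ennreal ((ln (1 - x + x * t) - ln (1 - x)) / t - (ln (1 - 0 + 0 * t) - ln (1 - 0)) / t)"
  proof (rule nn_integral_FTC_Ioo)
    fix y assume y: "0 \<le> y" "y \<le> x"
    have p: "0 < 1 - y + y * t" using y assms by (smt (verit) mult_nonneg_nonneg)
    have "((\<lambda>y. (ln (1 - y + y * t) - ln (1 - y)) / t) has_real_derivative
      ((- 1 + t) / (1 - y + y * t) - (- 1) / (1 - y)) / t) (at y)"
      using y p assms by (auto intro!: derivative_eq_intros)
    also have "((- 1 + t) / (1 - y + y * t) - (- 1) / (1 - y)) / t = 1 / ((1 - y) * (1 - y + y * t))"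
      using y p assms by (simp add: divide_simps) (simp add: algebra_simps)
    finally show "((\<lambda>y. (ln (1 - y + y * t) - ln (1 - y)) / t) has_real_derivative
      1 / ((1 - y) * (1 - y + y * t))) (at y)" .
    show "0 \<le> 1 / ((1 - y) * (1 - y + y * t))" using y p assms by simp
  qed (use assms in auto)
  then show ?thesis using assms kern_denominator_pos[of x t] by (simp add: ln_div)
qed

lemma nn_integral_kern_in_t:
  assumes "0 < x" "x < 1" "0 < s" "s \<le> 1"
  shows "(\<integral>\<^sup>+r\<in>{0<..<s}. ennreal (x / (1 - x + x * r)) \<partial>lborel) =
    ennreal (ln ((1 - x + x * s) / (1 - x)))"
proof -
  have "(\<integral>\<^sup>+r\<in>{0<..<s}. ennreal (x / (1 - x + x * r)) \<partial>lborel) =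
    ennreal (ln (1 - x + x * s) - ln (1 - x + x * 0))"
  proof (rule nn_integral_FTC_Ioo)
    fix r assume r: "0 \<le> r" "r \<le> s"
    have p: "0 < 1 - x + x * r" using r assms kern_denominator_pos by auto
    show "((\<lambda>r. ln (1 - x + x * r)) has_real_derivative x / (1 - x + x * r)) (at r)"
      using p by (auto intro!: derivative_eq_intros)
    show "0 \<le> x / (1 - x + x * r)" using p assms by simp
  qed (use assms in auto)
  then show ?thesis using assms kern_denominator_pos[of x s] by (simp add: ln_div)
qed

text \<open>
  Both sides equal \<open>\<integral>\<^sub>0\<^sup>1 (L\<^sup>m / (m! t)) ln ((1 - x + x t) / (1 - x)) dt\<close>: on the left, integrate over
  \<open>y\<close> first; on the right, write \<open>L\<^sup>m\<^sup>+\<^sup>1 / (m+1)!\<close> as the integral of \<open>L\<^sup>m / (m! s)\<close> over \<open>s \<in> (r,1)\<close>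
  and integrate over \<open>r < s\<close> first. All integrands are nonnegative, so Tonelli's theorem gives
  both exchanges.
\<close>

lemma nn_integral_Cesaro_kern:
  assumes x: "0 < x" "x < 1"
  shows "(\<integral>\<^sup>+y\<in>{0<..<x}. (ennreal (1 / (1 - y)) *
            (\<integral>\<^sup>+t\<in>{0<..<1}. ennreal (log_weight m t / (1 - y + y * t)) \<partial>lborel)) \<partial>lborel) =
         ennreal x * (\<integral>\<^sup>+t\<in>{0<..<1}. ennreal (log_weight (Suc m) t / (1 - x + x * t)) \<partial>lborel)"
    (is "?L = ?R")
proof -
  let ?ln = "\<lambda>t. ln ((1 - x + x * t) / (1 - x))"
  have "?L = (\<integral>\<^sup>+y. (\<integral>\<^sup>+t. ennreal (log_weight m t) * indicator {0<..<1} t *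
      (ennreal (1 / ((1 - y) * (1 - y + y * t))) * indicator {0<..<x} y) \<partial>lborel) \<partial>lborel)"
  proof (rule nn_integral_cong)
    fix y
    show "ennreal (1 / (1 - y)) * (\<integral>\<^sup>+t\<in>{0<..<1}. ennreal (log_weight m t / (1 - y + y * t)) \<partial>lborel) *
        indicator {0<..<x} y = (\<integral>\<^sup>+t. ennreal (log_weight m t) * indicator {0<..<1} t *
      (ennreal (1 / ((1 - y) * (1 - y + y * t))) * indicator {0<..<x} y) \<partial>lborel)"
    proof (cases "y \<in> {0<..<x}")
      case True
      have "ennreal (1 / (1 - y)) * (ennreal (log_weight m t / (1 - y + y * t)) * indicator {0<..<1} t) =
        ennreal (log_weight m t) * indicator {0<..<1} t * ennreal (1 / ((1 - y) * (1 - y + y * t)))" for t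
      proof (cases "t \<in> {0<..<1}")
        case t: True
        have "ennreal (1 / (1 - y)) * ennreal (log_weight m t / (1 - y + y * t)) =
          ennreal (1 / (1 - y) * (log_weight m t / (1 - y + y * t)))"
          using True x by (intro ennreal_mult'[symmetric]) auto
        also have "\<dots> = ennreal (log_weight m t * (1 / ((1 - y) * (1 - y + y * t))))"
          by simp
        also have "\<dots> = ennreal (log_weight m t) * ennreal (1 / ((1 - y) * (1 - y + y * t)))"
          using t log_weight_nonneg[of t m] by (intro ennreal_mult') auto
        finally show ?thesis using t by simp
      qed auto
      then show ?thesis using True by (simp flip: nn_integral_cmult)
    qed auto
  qed
  also have "\<dots> = (\<integral>\<^sup>+t. (\<integral>\<^sup>+y. ennreal (log_weight m t) * indicator {0<..<1} t *
      (ennreal (1 / ((1 - y) * (1 - y + y * t))) * indicator {0<..<x} y) \<partial>lborel) \<partial>lborel)"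
    by (rule lborel_pair.Fubini') measurable
  also have "\<dots> = (\<integral>\<^sup>+t\<in>{0<..<1}. ennreal (log_weight m t / t * ?ln t) \<partial>lborel)"
  proof (rule nn_integral_cong)
    fix t :: real
    show "(\<integral>\<^sup>+y. ennreal (log_weight m t) * indicator {0<..<1} t *
      (ennreal (1 / ((1 - y) * (1 - y + y * t))) * indicator {0<..<x} y) \<partial>lborel) =
      ennreal (log_weight m t / t * ?ln t) * indicator {0<..<1} t"
      using x log_weight_nonneg[of t m]
      by (auto split: split_indicator simp: nn_integral_cmult nn_integral_kern_in_x simp flip: ennreal_mult')
  qed
  also have "\<dots> = (\<integral>\<^sup>+s. (\<integral>\<^sup>+r. ennreal (log_weight m s / s) * indicator {0<..<1} s *
      (ennreal (x / (1 - x + x * r)) * (if 0 < r \<and> r < s then 1 else 0)) \<partial>lborel) \<partial>lborel)"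
  proof (rule nn_integral_cong)
    fix s :: real
    have "(\<integral>\<^sup>+r. (ennreal (x / (1 - x + x * r)) * (if 0 < r \<and> r < s then 1 else 0)) \<partial>lborel) =
      ennreal (?ln s)" if "0 < s" "s \<le> 1"
      unfolding nn_integral_kern_in_t[OF x that, symmetric]
      by (intro nn_integral_cong) (auto split: split_indicator)
    then show "ennreal (log_weight m s / s * ?ln s) * indicator {0<..<1} s =
      (\<integral>\<^sup>+r. ennreal (log_weight m s / s) * indicator {0<..<1} s *
      (ennreal (x / (1 - x + x * r)) * (if 0 < r \<and> r < s then 1 else 0)) \<partial>lborel)"
      using log_weight_nonneg[of s m]
      by (auto split: split_indicator simp: nn_integral_cmult simp flip: ennreal_mult')
  qed
  also have "\<dots> = (\<integral>\<^sup>+r. (\<integral>\<^sup>+s. ennreal (log_weight m s / s) * indicator {0<..<1} s *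
      (ennreal (x / (1 - x + x * r)) * (if 0 < r \<and> r < s then 1 else 0)) \<partial>lborel) \<partial>lborel)"
    by (rule lborel_pair.Fubini') measurable
  also have "\<dots> = (\<integral>\<^sup>+r. ennreal x * (ennreal (log_weight (Suc m) r / (1 - x + x * r)) * indicator {0<..<1} r) \<partial>lborel)"
  proof (rule nn_integral_cong)
    fix r :: real
    have "(\<integral>\<^sup>+s. ennreal (log_weight m s / s) * indicator {0<..<1} s *
        (ennreal (x / (1 - x + x * r)) * (if 0 < r \<and> r < s then 1 else 0)) \<partial>lborel) =
       (\<integral>\<^sup>+s. ennreal (x / (1 - x + x * r)) * indicator {0<..<1} r *
        (ennreal (log_weight m s / s) * indicator {r<..<1} s) \<partial>lborel)"
      by (intro nn_integral_cong) (auto split: split_indicator simp: mult.commute)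
    also have "\<dots> = ennreal (x / (1 - x + x * r)) * indicator {0<..<1} r *
        (\<integral>\<^sup>+s\<in>{r<..<1}. ennreal (log_weight m s / s) \<partial>lborel)"
      by (intro nn_integral_cmult) measurable
    also have "\<dots> = ennreal x * (ennreal (log_weight (Suc m) r / (1 - x + x * r)) * indicator {0<..<1} r)"
      using x kern_denominator_pos[of x r] log_weight_nonneg[of r "Suc m"]
      by (auto split: split_indicator simp: nn_integral_log_weight simp flip: ennreal_mult)
    finally show "(\<integral>\<^sup>+s. ennreal (log_weight m s / s) * indicator {0<..<1} s *
        (ennreal (x / (1 - x + x * r)) * (if 0 < r \<and> r < s then 1 else 0)) \<partial>lborel) =
      ennreal x * (ennreal (log_weight (Suc m) r / (1 - x + x * r)) * indicator {0<..<1} r)" .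
  qed
  also have "\<dots> = ?R"
    by (intro nn_integral_cmult) measurable
  finally show ?thesis .
qed

lemma C_op_cong:
  assumes "\<And>t. 0 < t \<Longrightarrow> t < x \<Longrightarrow> f t = g t"
  shows "C_op f x = C_op g x"
proof -
  have "(LINT t:{0<..<x}|lebesgue. f t / of_real (1 - t)) = (LINT t:{0<..<x}|lebesgue. g t / of_real (1 - t))"
    by (intro set_lebesgue_integral_cong) (auto simp: assms)
  then show ?thesis by (simp add: C_op_def)
qed

lemma C_op_of_real:
  assumes [measurable]: "g \<in> borel_measurable borel"
    and x: "0 < x" "x < 1" and g: "\<And>t. 0 < t \<Longrightarrow> t < x \<Longrightarrow> 0 \<le> g t"
  shows "C_op (\<lambda>t. of_real (g t)) x =
    of_real (1 / x * enn2real (\<integral>\<^sup>+y\<in>{0<..<x}. (ennreal (1 / (1 - y)) * ennreal (g y)) \<partial>lborel))"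
proof -
  have "(LINT t:{0<..<x}|lebesgue. complex_of_real (g t) / of_real (1 - t)) =
      of_real (LINT t:{0<..<x}|lebesgue. g t / (1 - t))"
    by (subst set_integral_complex_of_real[symmetric]) simp
  also have "(LINT t:{0<..<x}|lebesgue. g t / (1 - t)) = (LBINT t:{0<..<x}. g t / (1 - t))"
    unfolding set_lebesgue_integral_def by (intro integral_completion) measurable
  also have "\<dots> = enn2real (\<integral>\<^sup>+t. ennreal (indicator {0<..<x} t *\<^sub>R (g t / (1 - t))) \<partial>lborel)"
    unfolding set_lebesgue_integral_def
    using x g by (intro integral_eq_nn_integral) (auto split: split_indicator)
  also have "(\<integral>\<^sup>+t. ennreal (indicator {0<..<x} t *\<^sub>R (g t / (1 - t))) \<partial>lborel) =
    (\<integral>\<^sup>+y\<in>{0<..<x}. (ennreal (1 / (1 - y)) * ennreal (g y)) \<partial>lborel)"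
    using x g by (intro nn_integral_cong) (auto split: split_indicator simp flip: ennreal_mult)
  finally show ?thesis by (simp add: C_op_def)
qed

lemma ennreal_kern:
  assumes "\<phi> \<in> borel_measurable borel"
    and "\<And>t. 0 < t \<Longrightarrow> t < 1 \<Longrightarrow> \<bar>\<phi> t\<bar> \<le> B * t powr (- a)" "a < 1" "0 < x" "x < 1"
    and "\<And>t. 0 < t \<Longrightarrow> t < 1 \<Longrightarrow> 0 \<le> \<phi> t"
  shows "(\<integral>\<^sup>+t\<in>{0<..<1}. ennreal (\<phi> t / (1 - x + x * t)) \<partial>lborel) = ennreal (kern \<phi> x)"
proof -
  have nonneg: "0 \<le> \<phi> t / (1 - x + x * t)" if "0 < t" "t < 1" for t
    using assms(6)[OF that] kern_denominator_pos[of x t] assms(4,5) that by simp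
  have "(\<integral>\<^sup>+t\<in>{0<..<1}. ennreal (\<phi> t / (1 - x + x * t)) \<partial>lborel) =
        (\<integral>\<^sup>+t. ennreal (indicator {0<..<1} t *\<^sub>R (\<phi> t / (1 - x + x * t))) \<partial>lborel)"
    by (intro nn_integral_cong) (auto split: split_indicator)
  also have "\<dots> = ennreal (kern \<phi> x)"
    unfolding kern_def set_lebesgue_integral_def
    using kern_integrable[OF assms(1-5)] nonneg
    by (intro nn_integral_eq_integral) (auto simp: set_integrable_def split: split_indicator)
  finally show ?thesis .
qed

lemma kern_nonneg:
  assumes "\<And>t. 0 < t \<Longrightarrow> t < 1 \<Longrightarrow> 0 \<le> \<phi> t" "0 < x" "x < 1"
  shows "0 \<le> kern \<phi> x"
  unfolding kern_def set_lebesgue_integral_def using assms kern_denominator_pos[of x]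
  by (intro integral_nonneg_AE) (auto split: split_indicator intro!: divide_nonneg_nonneg less_imp_le)

lemma ennreal_kern_log_weight:
  assumes "0 < x" "x < 1"
  shows "(\<integral>\<^sup>+t\<in>{0<..<1}. ennreal (log_weight m t / (1 - x + x * t)) \<partial>lborel) =
    ennreal (kern (log_weight m) x)"
proof (rule ennreal_kern[where a = "1/2"])
  fix t :: real assume "0 < t" "t < 1"
  then show "\<bar>log_weight m t\<bar> \<le> 1 / (1/2) ^ m * t powr (- (1/2))" "0 \<le> log_weight m t"
    using log_weight_bound[of t "1/2" m] log_weight_nonneg[of t m] by auto
qed (use assms in auto)

lemma C_op_kern_log_weight:
  assumes x: "0 < x" "x < 1"
  shows "C_op (\<lambda>t. of_real (kern (log_weight m) t)) x = of_real (kern (log_weight (Suc m)) x)"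
proof -
  have nn: "0 \<le> kern (log_weight k) t" if "0 < t" "t < 1" for k t
    using that by (intro kern_nonneg log_weight_nonneg) auto
  have "(\<integral>\<^sup>+y\<in>{0<..<x}. (ennreal (1 / (1 - y)) * ennreal (kern (log_weight m) y)) \<partial>lborel) =
    (\<integral>\<^sup>+y\<in>{0<..<x}. (ennreal (1 / (1 - y)) *
            (\<integral>\<^sup>+t\<in>{0<..<1}. ennreal (log_weight m t / (1 - y + y * t)) \<partial>lborel)) \<partial>lborel)"
    using x by (intro nn_integral_cong) (auto split: split_indicator simp: ennreal_kern_log_weight)
  also have "\<dots> = ennreal x * ennreal (kern (log_weight (Suc m)) x)"
    using x by (simp add: nn_integral_Cesaro_kern ennreal_kern_log_weight)
  finally show ?thesis
    using x nn by (simp add: C_op_of_real enn2real_mult)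
qed

lemma C_op_one:
  assumes x: "0 < x" "x < 1"
  shows "C_op (\<lambda>_. 1) x = of_real (kern (log_weight 0) x)"
proof -
  have "ennreal x * ennreal (kern (log_weight 0) x) = (\<integral>\<^sup>+t\<in>{0<..<1}. ennreal (x / (1 - x + x * t)) \<partial>lborel)"
    unfolding ennreal_kern_log_weight[OF x, symmetric]
    using x by (subst nn_integral_cmult[symmetric])
      (auto simp: log_weight_def intro!: nn_integral_cong split: split_indicator simp flip: ennreal_mult')
  also have "\<dots> = ennreal (ln (1 / (1 - x)))"
    using nn_integral_kern_in_t[OF x, of 1] by simp
  also have "\<dots> = ennreal (- ln (1 - x) - (- ln (1 - 0)))"
    using x by (simp add: ln_div)
  also have "\<dots> = (\<integral>\<^sup>+y\<in>{0<..<x}. ennreal (1 / (1 - y)) \<partial>lborel)"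
    using x by (intro nn_integral_FTC_Ioo[symmetric]) (auto intro!: derivative_eq_intros)
  finally have "(\<integral>\<^sup>+y\<in>{0<..<x}. (ennreal (1 / (1 - y)) * ennreal 1) \<partial>lborel) =
    ennreal x * ennreal (kern (log_weight 0) x)" by simp
  moreover have "0 \<le> kern (log_weight 0) x"
    using x by (intro kern_nonneg log_weight_nonneg) auto
  ultimately show ?thesis
    using x C_op_of_real[of "\<lambda>_. 1" x] by (simp add: enn2real_mult)
qed

lemma funpow_C_op_one:
  assumes "0 < x" "x < 1"
  shows "(C_op ^^ Suc m) (\<lambda>_. 1) x = of_real (kern (log_weight m) x)"
  using assms
proof (induction m arbitrary: x)
  case 0
  then show ?case by (simp add: C_op_one)
next
  case (Suc m)
  have "(C_op ^^ Suc (Suc m)) (\<lambda>_. 1) x = C_op (\<lambda>t. of_real (kern (log_weight m) t)) x"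
    using Suc by (simp only: funpow.simps(2)[of "Suc m"] o_apply) (intro C_op_cong, auto)
  then show ?case using Suc.prems by (simp only: C_op_kern_log_weight)
qed

lemma funpow_C_op_one_in_Lp:
  assumes "1 < p"
  shows "(C_op ^^ n) (\<lambda>_. 1) \<in> Lp p"
proof (cases n)
  case 0
  have "integrable unit_leb (\<lambda>x. (1 - x) powr (- 0))"
    by (rule integrable_unit_leb_reflected_powr) auto
  then have "integrable unit_leb (\<lambda>x. 1 powr p)"
    by (rule Bochner_Integration.integrable_cong[THEN iffD1, rotated -1]) auto
  then show ?thesis unfolding 0 by (simp add: Lp_def)
next
  case (Suc m)
  have "(\<lambda>x. complex_of_real (kern (log_weight m) x)) \<in> Lp p"
  proof (rule kern_in_Lp[OF assms])
    show "\<bar>log_weight m t\<bar> \<le> 1 / (1 / (2 * p)) ^ m * t powr (- (1 / (2 * p)))" if "0 < t" "t < 1" for t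
      using that assms by (intro log_weight_bound) auto
  qed (use assms in \<open>auto simp: field_simps\<close>)
  then show ?thesis
    unfolding Suc by (rule iffD2[OF Lp_cong, rotated]) (rule funpow_C_op_one)
qed

section \<open>The closed span of the orbit\<close>

definition orbit_closure :: "real \<Rightarrow> (real \<Rightarrow> complex) set" where
  "orbit_closure p = Lp_closure p (cfun.span {(C_op ^^ n) (\<lambda>_. 1) | n. True})"

lemma orbit_closure_add:
  assumes "1 < p" "f \<in> orbit_closure p" "g \<in> orbit_closure p"
  shows "(\<lambda>x. f x + g x) \<in> orbit_closure p"
  using assms cfun.span_add unfolding orbit_closure_def
  by (intro Lp_closure_add) (auto simp: plus_fun_def)

lemma orbit_closure_scale:
  assumes "1 < p" "f \<in> orbit_closure p"
  shows "(\<lambda>x. c * f x) \<in> orbit_closure p"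
  using assms cfun.span_scale unfolding orbit_closure_def
  by (intro Lp_closure_scale) auto

lemma orbit_subset_closure:
  assumes "1 < p"
  shows "(C_op ^^ n) (\<lambda>_. 1) \<in> orbit_closure p"
  using subset_Lp_closure[of "cfun.span {(C_op ^^ n) (\<lambda>_. 1) | n. True}" p]
    cfun.span_superset[of "{(C_op ^^ n) (\<lambda>_. 1) | n. True}"] funpow_C_op_one_in_Lp[OF assms, of n]
  unfolding orbit_closure_def by blast

lemma orbit_closure_sum:
  assumes "1 < p" "finite I" "\<And>i. i \<in> I \<Longrightarrow> f i \<in> orbit_closure p"
  shows "(\<lambda>x. \<Sum>i\<in>I. f i x) \<in> orbit_closure p"
  using assms(2,3)
proof (induction I rule: finite_induct)
  case empty
  have "(\<lambda>x. 0 * (C_op ^^ 0) (\<lambda>_. 1) x) \<in> orbit_closure p"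
    by (intro orbit_closure_scale orbit_subset_closure assms)
  then show ?case by simp
next
  case (insert i I)
  then show ?case using orbit_closure_add[OF assms(1), of "f i"] by simp
qed

lemma orbit_closure_cong:
  assumes "1 < p" "f \<in> orbit_closure p" "\<And>x. 0 < x \<Longrightarrow> x < 1 \<Longrightarrow> f x = g x"
  shows "g \<in> orbit_closure p"
  using assms Lp_closure_cong[of p f _ g] unfolding orbit_closure_def by auto

lemma orbit_closure_bounded_limit:
  assumes p: "1 < p" and f: "\<And>n. f n \<in> orbit_closure p"
    and bound: "\<And>n x. 0 < x \<Longrightarrow> x < 1 \<Longrightarrow> norm (f n x) \<le> B"
    and lim: "AE x in unit_leb. (\<lambda>n. f n x) \<longlonglongrightarrow> g x"
    and g: "g \<in> borel_measurable unit_leb"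
  shows "g \<in> orbit_closure p"
  unfolding orbit_closure_def
proof (rule Lp_closure_dominated_limit[OF _ f[unfolded orbit_closure_def] _ _ lim g])
  have "integrable unit_leb (\<lambda>x. B powr p * (1 - x) powr (- 0))"
    by (intro integrable_mult_right integrable_unit_leb_reflected_powr) auto
  then show "integrable unit_leb (\<lambda>x. B powr p)"
    by (rule Bochner_Integration.integrable_cong[THEN iffD1, rotated -1]) auto
  show "AE x in unit_leb. norm (f n x) \<le> B" for n
    by (intro AE_unit_leb_I bound)
qed (use p in auto)

section \<open>Powers of \<open>t\<close> as densities\<close>

lemma kern_dominated_limit:
  fixes \<phi> :: "nat \<Rightarrow> real \<Rightarrow> real"
  assumes "1 < p" "0 \<le> a" "a < 1 / p"
    and meas: "\<And>n. \<phi> n \<in> borel_measurable borel" "\<psi> \<in> borel_measurable borel"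
    and bound: "\<And>n t. 0 < t \<Longrightarrow> t < 1 \<Longrightarrow> \<bar>\<phi> n t\<bar> \<le> B * t powr (- a)"
    and lim: "\<And>t. 0 < t \<Longrightarrow> t < 1 \<Longrightarrow> (\<lambda>n. \<phi> n t) \<longlonglongrightarrow> \<psi> t"
    and mem: "\<And>n. (\<lambda>x. of_real (kern (\<phi> n) x)) \<in> orbit_closure p"
  shows "(\<lambda>x. of_real (kern \<psi> x)) \<in> orbit_closure p"
proof -
  have a1: "a < 1" using assms(1,3) by (smt (verit) divide_less_eq_1_pos)
  obtain G where G: "integrable unit_leb (\<lambda>x. G x powr p)"
    "\<And>\<phi> x. \<phi> \<in> borel_measurable borel \<Longrightarrow>
          (\<And>t. 0 < t \<Longrightarrow> t < 1 \<Longrightarrow> \<bar>\<phi> t\<bar> \<le> B * t powr (- a)) \<Longrightarrow> 0 < x \<Longrightarrow> x < 1 \<Longrightarrow>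
          \<bar>kern \<phi> x\<bar> \<le> G x"
    using kern_Lp_dominator[of p a B] assms by metis
  have conv: "(\<lambda>n. kern (\<phi> n) x) \<longlonglongrightarrow> kern \<psi> x" if x: "0 < x" "x < 1" for x
    unfolding kern_def set_lebesgue_integral_def
  proof (rule integral_dominated_convergence)
    show "integrable lborel (\<lambda>t. indicator {0<..<1} t *\<^sub>R (B * (1 - x) powr (- 1) * t powr (1 - a - 1)))"
      unfolding set_integrable_def[symmetric]
      by (rule set_integrable_mult_right, rule set_integrable_powr_01) (use a1 in auto)
    show "AE t in lborel. (\<lambda>n. indicator {0<..<1} t *\<^sub>R (\<phi> n t / (1 - x + x * t))) \<longlonglongrightarrow>
        indicator {0<..<1} t *\<^sub>R (\<psi> t / (1 - x + x * t))"
    proof (rule AE_I2)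
      fix t
      show "(\<lambda>n. indicator {0<..<1} t *\<^sub>R (\<phi> n t / (1 - x + x * t))) \<longlonglongrightarrow>
        indicator {0<..<1} t *\<^sub>R (\<psi> t / (1 - x + x * t))"
        using kern_denominator_pos[OF x, of t]
        by (cases "t \<in> {0<..<1}") (auto intro!: tendsto_intros lim)
    qed
    show "AE t in lborel. norm (indicator {0<..<1} t *\<^sub>R (\<phi> n t / (1 - x + x * t))) \<le>
      indicator {0<..<1} t *\<^sub>R (B * (1 - x) powr (- 1) * t powr (1 - a - 1))" for n
      using kern_integrand_bound[of "\<phi> n" _ B a 1 x] bound[of _ n] x
      by (intro AE_I2) (auto split: split_indicator)
  qed (use meas in measurable)
  show ?thesis
    unfolding orbit_closure_def
  proof (rule Lp_closure_dominated_limit[OF _ mem[unfolded orbit_closure_def] G(1)])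
    show "AE x in unit_leb. cmod (complex_of_real (kern (\<phi> n) x)) \<le> G x" for n
      using G(2)[OF meas(1) bound] by (intro AE_unit_leb_I) auto
    show "AE x in unit_leb. (\<lambda>n. complex_of_real (kern (\<phi> n) x)) \<longlonglongrightarrow> complex_of_real (kern \<psi> x)"
      by (intro AE_unit_leb_I tendsto_of_real conv)
    show "(\<lambda>x. complex_of_real (kern \<psi> x)) \<in> borel_measurable unit_leb"
      using meas by (intro borel_measurable_unit_leb_of_real kern_borel_measurable)
  qed (use assms in auto)
qed

lemma kern_log_power_mem:
  assumes p: "1 < p"
  shows "(\<lambda>x. of_real (kern (\<lambda>t. (- ln t) ^ m) x)) \<in> orbit_closure p"
proof -
  have "(\<lambda>x. of_real (fact m) * (C_op ^^ Suc m) (\<lambda>_. 1) x) \<in> orbit_closure p"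
    by (intro orbit_closure_scale orbit_subset_closure p)
  then show ?thesis
  proof (rule orbit_closure_cong[OF p])
    fix x :: real assume x: "0 < x" "x < 1"
    have "fact m * kern (log_weight m) x = kern (\<lambda>t. (- ln t) ^ m) x"
      unfolding kern_def log_weight_def by (simp flip: set_integral_mult_right)
    then show "of_real (fact m) * (C_op ^^ Suc m) (\<lambda>_. 1) x = complex_of_real (kern (\<lambda>t. (- ln t) ^ m) x)"
      using funpow_C_op_one[OF x, of m] by (metis of_real_mult)
  qed
qed

lemma powr_log_power_bound:
  fixes t \<beta> d :: real
  assumes "0 < t" "t < 1" "0 < d" "0 \<le> \<beta>"
  shows "\<bar>t powr \<beta> * (- ln t) ^ m\<bar> \<le> fact m / d ^ m * t powr (- d)"
proof -
  have "\<bar>t powr \<beta> * (- ln t) ^ m\<bar> = t powr \<beta> * (- ln t) ^ m"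
    using assms by (intro abs_of_nonneg) auto
  also have "\<dots> \<le> 1 * (- ln t) ^ m"
    using assms by (intro mult_right_mono powr_le1) auto
  also have "\<dots> \<le> fact m / d ^ m * t powr (- d)"
    using neg_ln_power_le assms by simp
  finally show ?thesis .
qed

text \<open>
  The factor \<open>t\<^sup>c\<close> is expanded as \<open>\<Sum>\<^sub>j (- c)\<^sup>j L\<^sup>j / j!\<close>. The powers of \<open>L\<close> are absorbed because the
  hypothesis is for all \<open>m\<close>.
\<close>

lemma kern_powr_log_power_shift:
  assumes p: "1 < p" and \<beta>: "0 \<le> \<beta>"
    and mem: "\<And>m. (\<lambda>x. of_real (kern (\<lambda>t. t powr \<beta> * (- ln t) ^ m) x)) \<in> orbit_closure p"
  shows "(\<lambda>x. of_real (kern (\<lambda>t. t powr (\<beta> + 1 / (4 * p)) * (- ln t) ^ m) x)) \<in> orbit_closure p"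
proof -
  \<comment> \<open>The partial sums cost \<open>t\<^sup>-\<^sup>c\<close> and the factor \<open>L\<^sup>m\<close> another \<open>t\<^sup>-\<^sup>c\<close>; so \<open>2 c < 1/p\<close> is required.\<close>
  define c where "c = 1 / (4 * p)"
  have c: "0 < c" "2 * c < 1 / p" "2 * c < 1" using p by (auto simp: c_def field_simps)
  let ?g = "\<lambda>m t. t powr \<beta> * (- ln t) ^ m"
  define \<phi> where "\<phi> n t = (\<Sum>j<n. (- c) ^ j / fact j * ?g (j + m) t)" for n t
  have \<phi>_alt: "\<phi> n t = ?g m t * (\<Sum>j<n. (c * ln t) ^ j / fact j)" for n t
    unfolding \<phi>_def sum_distrib_left
    by (intro sum.cong refl) (simp add: power_add power_mult_distrib[symmetric] mult_ac flip: power_mult_distrib)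
  show ?thesis
    unfolding c_def[symmetric]
  proof (rule kern_dominated_limit[where \<phi> = \<phi> and a = "2 * c" and B = "fact m / c ^ m"])
    show "\<phi> n \<in> borel_measurable borel" for n unfolding \<phi>_def by measurable
    show "(\<lambda>t. t powr (\<beta> + c) * (- ln t) ^ m) \<in> borel_measurable borel" by measurable
  next
    fix n and t :: real assume t: "0 < t" "t < 1"
    have L: "0 \<le> c * (- ln t)" using t c by (intro mult_nonneg_nonneg) auto
    have "\<bar>\<Sum>j<n. (c * ln t) ^ j / fact j\<bar> \<le> (\<Sum>j<n. \<bar>(c * ln t) ^ j / fact j\<bar>)"
      by (rule sum_abs)
    also have "\<dots> = (\<Sum>j<n. (c * (- ln t)) ^ j /\<^sub>R fact j)"
      using t c by (intro sum.cong refl) (simp add: abs_mult power_abs divide_inverse mult.commute)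
    also have "\<dots> \<le> exp (c * (- ln t))"
      unfolding exp_def
      by (intro sum_le_suminf summable_exp_generic) (use zero_le_power[OF L] in auto)
    also have "\<dots> = t powr (- c)" using t by (simp add: powr_def)
    finally have "\<bar>\<phi> n t\<bar> \<le> (fact m / c ^ m * t powr (- c)) * t powr (- c)"
      unfolding \<phi>_alt abs_mult[of "?g m t"] using t c \<beta> powr_log_power_bound[of t c \<beta> m]
      by (intro mult_mono) auto
    also have "\<dots> = fact m / c ^ m * t powr (- (2 * c))"
      by (simp add: mult.assoc flip: powr_add)
    finally show "\<bar>\<phi> n t\<bar> \<le> fact m / c ^ m * t powr (- (2 * c))" .
  next
    fix t :: real assume t: "0 < t" "t < 1"
    have "(\<lambda>j. (c * ln t) ^ j /\<^sub>R fact j) sums exp (c * ln t)" by (rule exp_converges)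
    then have "(\<lambda>n. ?g m t * (\<Sum>j<n. (c * ln t) ^ j / fact j)) \<longlonglongrightarrow> ?g m t * exp (c * ln t)"
      unfolding sums_def by (intro tendsto_intros) (simp add: divide_inverse mult.commute)
    then show "(\<lambda>n. \<phi> n t) \<longlonglongrightarrow> t powr (\<beta> + c) * (- ln t) ^ m"
      using t unfolding \<phi>_alt by (simp add: powr_add powr_def[of t c] mult_ac)
  next
    fix n
    have "(\<lambda>x. \<Sum>j<n. of_real ((- c) ^ j / fact j) * of_real (kern (?g (j + m)) x)) \<in> orbit_closure p"
      by (intro orbit_closure_sum orbit_closure_scale mem p) auto
    then show "(\<lambda>x. complex_of_real (kern (\<phi> n) x)) \<in> orbit_closure p"
    proof (rule orbit_closure_cong[OF p])
      fix x :: real assume x: "0 < x" "x < 1"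
      have "kern (\<phi> n) x = (\<Sum>j<n. (- c) ^ j / fact j * kern (?g (j + m)) x)"
        unfolding \<phi>_def using c \<beta> x powr_log_power_bound[of _ c \<beta>]
        by (intro kern_lincomb[where a = c and B = "\<lambda>j. fact (j + m) / c ^ (j + m)"]) auto
      then show "(\<Sum>j<n. of_real ((- c) ^ j / fact j) * of_real (kern (?g (j + m)) x)) =
        complex_of_real (kern (\<phi> n) x)"
        by (simp only: of_real_sum of_real_mult)
    qed
  qed (use p c in auto)
qed

lemma kern_powr_log_power_mem:
  assumes p: "1 < p"
  shows "(\<lambda>x. of_real (kern (\<lambda>t. t powr (real N * (1 / (4 * p))) * (- ln t) ^ m) x)) \<in> orbit_closure p"
proof (induction N arbitrary: m)
  case 0
  show ?case
  proof (rule orbit_closure_cong[OF p kern_log_power_mem[OF p, of m]])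
    fix x
    show "complex_of_real (kern (\<lambda>t. (- ln t) ^ m) x) =
      of_real (kern (\<lambda>t. t powr (real 0 * (1 / (4 * p))) * (- ln t) ^ m) x)"
      by (intro arg_cong[where f = of_real] kern_cong) auto
  qed
next
  case (Suc N)
  have "real (Suc N) * (1 / (4 * p)) = real N * (1 / (4 * p)) + 1 / (4 * p)"
    by (simp add: algebra_simps add_divide_distrib)
  then show ?case
    using kern_powr_log_power_shift[OF p _ Suc.IH, of m] p by simp
qed

section \<open>Monomials\<close>

definition beta_moment :: "real \<Rightarrow> nat \<Rightarrow> real" where
  "beta_moment \<alpha> n = (LBINT t:{0<..<1}. t powr \<alpha> * (1 - t) ^ n)"

lemma beta_moment_eq_Beta:
  assumes "-1 < \<alpha>"
  shows "set_integrable lborel {0<..<1} (\<lambda>t. t powr \<alpha> * (1 - t) ^ n)"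
    and "beta_moment \<alpha> n = Beta (\<alpha> + 1) (real n + 1)"
proof -
  have "((\<lambda>t. t powr (\<alpha> + 1 - 1) * (1 - t) powr (real n + 1 - 1)) has_integral Beta (\<alpha> + 1) (real n + 1)) {0<..<1}"
    using has_integral_Beta_real[of "\<alpha> + 1" "real n + 1"] assms by (simp add: has_integral_Icc_iff_Ioo)
  then have h: "((\<lambda>t. t powr \<alpha> * (1 - t) ^ n) has_integral Beta (\<alpha> + 1) (real n + 1)) {0<..<1}"
    by (rule has_integral_eq[rotated]) (auto simp: powr_realpow)
  then have "set_integrable lebesgue {0<..<1} (\<lambda>t. t powr \<alpha> * (1 - t) ^ n)"
    by (intro nonnegative_absolutely_integrable_1) auto
  then show i: "set_integrable lborel {0<..<1} (\<lambda>t. t powr \<alpha> * (1 - t) ^ n)"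
    unfolding set_integrable_def by (subst (asm) integrable_completion) auto
  show "beta_moment \<alpha> n = Beta (\<alpha> + 1) (real n + 1)"
    unfolding beta_moment_def
    using set_borel_integral_eq_integral(2)[OF i] h by (simp add: integral_unique)
qed

lemma beta_moment_pos: "-1 < \<alpha> \<Longrightarrow> 0 < beta_moment \<alpha> n"
  by (simp add: beta_moment_eq_Beta Beta_def)

text \<open>
  Integration by parts, read off from the functional equations of the Beta function.
\<close>

lemma beta_moment_shift:
  assumes "0 < \<alpha>"
  shows "beta_moment (\<alpha> - 1) (Suc n) = (real n + 1) / \<alpha> * beta_moment \<alpha> n"
proof -
  define s where "s = \<alpha> + (real n + 1)"
  have X: "s * Beta \<alpha> (real n + 1 + 1) = (real n + 1) * Beta \<alpha> (real n + 1)"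
    unfolding s_def by (rule Beta_plus1_right) (auto elim!: nonpos_Ints_cases)
  have Z: "s * Beta (\<alpha> + 1) (real n + 1) = \<alpha> * Beta \<alpha> (real n + 1)"
    unfolding s_def using assms by (intro Beta_plus1_left) (auto elim!: nonpos_Ints_cases)
  have "s * (\<alpha> * Beta \<alpha> (real n + 1 + 1)) = s * ((real n + 1) * Beta (\<alpha> + 1) (real n + 1))"
    using X Z by algebra
  moreover have "s \<noteq> 0" using assms by (simp add: s_def)
  ultimately have "Beta \<alpha> (real n + 1 + 1) = (real n + 1) / \<alpha> * Beta (\<alpha> + 1) (real n + 1)"
    using assms by (simp add: nonzero_eq_divide_eq mult.commute)
  moreover have "beta_moment (\<alpha> - 1) (Suc n) = Beta \<alpha> (real n + 1 + 1)"
    using beta_moment_eq_Beta(2)[of "\<alpha> - 1" "Suc n"] assms by (simp add: ac_simps)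
  ultimately show ?thesis using assms by (simp add: beta_moment_eq_Beta)
qed

text \<open>
  With \<open>u = 1 - t\<close> the kernel is a geometric series in \<open>x u\<close>. After the first \<open>n\<close> terms are removed
  and the rest is normalised, the relative error with respect to \<open>x\<^sup>n\<close> is the mean of \<open>x u / (1 - x u)\<close> over the
  density \<open>t\<^sup>\<alpha> u\<^sup>n\<close>. As \<open>1 - x u \<ge> t\<close>, that mean is at most the mean of \<open>u / t\<close>, a quotient of Beta
  integrals, for every \<open>x\<close>.
\<close>

lemma kern_powr_expansion:
  fixes \<alpha> x :: real
  assumes \<alpha>: "0 < \<alpha>" and x: "0 < x" "x < 1"
  shows "\<bar>(kern (\<lambda>t. t powr \<alpha>) x - (\<Sum>k<n. beta_moment \<alpha> k * x ^ k)) / beta_moment \<alpha> n - x ^ n\<bar>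
    \<le> (real n + 1) / \<alpha>"
proof -
  let ?I = "\<lambda>f. (LBINT t:{0<..<1}. f t)"
  let ?w = "\<lambda>k t. t powr \<alpha> * (1 - t) ^ k"
  let ?rest = "\<lambda>t. ?w n t * (x * (1 - t)) / (1 - x + x * t)"
  have w: "set_integrable lborel {0<..<1} (?w k)" for k
    using \<alpha> by (intro beta_moment_eq_Beta) auto
  have D: "0 < 1 - x + x * t" "t \<le> 1 - x + x * t" if "0 < t" "t < 1" for t
  proof -
    show "0 < 1 - x + x * t" using kern_denominator_pos that x by auto
    have "0 \<le> (1 - x) * (1 - t)" using x that by simp
    then show "t \<le> 1 - x + x * t" by (simp add: algebra_simps)
  qed
  have next_int: "set_integrable lborel {0<..<1} (\<lambda>t. t powr (\<alpha> - 1) * (1 - t) ^ Suc n)"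
    using \<alpha> by (intro beta_moment_eq_Beta) auto
  have rest: "0 \<le> ?rest t" "?rest t \<le> t powr (\<alpha> - 1) * (1 - t) ^ Suc n" if t: "0 < t" "t < 1" for t
  proof -
    show "0 \<le> ?rest t" using t x D[OF t] by simp
    have "?rest t \<le> (?w n t * (1 * (1 - t))) / t"
      using t x D[OF t] by (intro frac_le mult_left_mono mult_right_mono) auto
    also have "\<dots> = t powr (\<alpha> - 1) * (1 - t) ^ Suc n"
      using t by (simp add: powr_diff)
    finally show "?rest t \<le> t powr (\<alpha> - 1) * (1 - t) ^ Suc n" .
  qed
  have rest_int: "set_integrable lborel {0<..<1} ?rest"
    using next_int
  proof (rule set_integrable_bound)
    show "set_borel_measurable lborel {0<..<1} ?rest"
      unfolding set_borel_measurable_def by measurable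
    show "AE t\<in>{0<..<1} in lborel. norm (?rest t) \<le> norm (t powr (\<alpha> - 1) * (1 - t) ^ Suc n)"
    proof (intro AE_I2 impI)
      fix t :: real assume "t \<in> {0<..<1}"
      then have "0 \<le> ?rest t" "?rest t \<le> t powr (\<alpha> - 1) * (1 - t) ^ Suc n"
        using rest[of t] by auto
      then show "norm (?rest t) \<le> norm (t powr (\<alpha> - 1) * (1 - t) ^ Suc n)"
        unfolding real_norm_def by linarith
    qed
  qed
  have geometric: "t powr \<alpha> / (1 - x + x * t) = (\<Sum>k<n. x ^ k * ?w k t) + x ^ n * (?w n t + ?rest t)"
    if t: "0 < t" "t < 1" for t
  proof -
    let ?q = "x * (1 - t)" and ?d = "1 - x + x * t"
    have d: "?d = 1 - ?q" "?d \<noteq> 0" using D(1)[OF t] by (auto simp: algebra_simps)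
    have "1 - ?q ^ n = ?d * (\<Sum>k<n. ?q ^ k)"
      unfolding d(1) by (rule one_diff_power_eq)
    then have "1 / ?d = (\<Sum>k<n. ?q ^ k) + ?q ^ n / ?d"
      using d(2) by (simp add: field_simps)
    also have "?q ^ n / ?d = ?q ^ n * (1 + ?q / ?d)"
      using d by (simp add: field_simps)
    finally have "t powr \<alpha> * (1 / ?d) = t powr \<alpha> * ((\<Sum>k<n. ?q ^ k) + ?q ^ n * (1 + ?q / ?d))"
      by simp
    then show ?thesis
      by (simp add: distrib_left sum_distrib_left power_mult_distrib mult_ac)
  qed
  have "kern (\<lambda>t. t powr \<alpha>) x = ?I (\<lambda>t. (\<Sum>k<n. x ^ k * ?w k t) + x ^ n * (?w n t + ?rest t))"
    unfolding kern_def using geometric by (intro set_lebesgue_integral_cong) auto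
  also have "\<dots> = ?I (\<lambda>t. \<Sum>k<n. x ^ k * ?w k t) + x ^ n * ?I (\<lambda>t. ?w n t + ?rest t)"
  proof -
    have "set_integrable lborel {0<..<1} (\<lambda>t. \<Sum>k<n. x ^ k * ?w k t)"
      using w by (intro set_integral_finite_sum set_integrable_mult_right)
    moreover have "set_integrable lborel {0<..<1} (\<lambda>t. x ^ n * (?w n t + ?rest t))"
      using w rest_int by (intro set_integrable_mult_right set_integral_add)
    ultimately show ?thesis by (subst set_integral_add) simp_all
  qed
  also have "?I (\<lambda>t. ?w n t + ?rest t) = beta_moment \<alpha> n + ?I ?rest"
    unfolding beta_moment_def using w rest_int by (intro set_integral_add)
  also have "?I (\<lambda>t. \<Sum>k<n. x ^ k * ?w k t) = (\<Sum>k<n. x ^ k * beta_moment \<alpha> k)"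
    unfolding beta_moment_def using w by (subst set_integral_finite_sum) auto
  finally have eq: "kern (\<lambda>t. t powr \<alpha>) x - (\<Sum>k<n. beta_moment \<alpha> k * x ^ k) =
    x ^ n * (beta_moment \<alpha> n + ?I ?rest)"
    by (simp add: mult.commute)
  have I0: "0 \<le> ?I ?rest"
    unfolding set_lebesgue_integral_def using rest(1)
    by (intro integral_nonneg_AE) (auto split: split_indicator)
  have "?I ?rest \<le> beta_moment (\<alpha> - 1) (Suc n)"
    unfolding beta_moment_def using rest(2) by (intro set_integral_mono rest_int next_int) auto
  also have "\<dots> = (real n + 1) / \<alpha> * beta_moment \<alpha> n"
    by (rule beta_moment_shift[OF \<alpha>])
  finally have I1: "?I ?rest / beta_moment \<alpha> n \<le> (real n + 1) / \<alpha>"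
    using beta_moment_pos[of \<alpha> n] \<alpha> by (simp add: field_simps)
  have "(kern (\<lambda>t. t powr \<alpha>) x - (\<Sum>k<n. beta_moment \<alpha> k * x ^ k)) / beta_moment \<alpha> n - x ^ n =
    x ^ n * (?I ?rest / beta_moment \<alpha> n)"
    unfolding eq using beta_moment_pos[of \<alpha> n] \<alpha> by (simp add: field_simps)
  moreover have "0 \<le> x ^ n" "x ^ n \<le> 1" using x by (auto simp: power_le_one)
  moreover have "0 \<le> ?I ?rest / beta_moment \<alpha> n" using I0 beta_moment_pos[of \<alpha> n] \<alpha> by simp
  ultimately show ?thesis
    using I1 mult_left_le_one_le[of "?I ?rest / beta_moment \<alpha> n" "x ^ n"]
      mult_nonneg_nonneg[of "x ^ n" "?I ?rest / beta_moment \<alpha> n"] by linarith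
qed

lemma monomial_mem_orbit_closure:
  assumes p: "1 < p"
  shows "(\<lambda>x. of_real x ^ n) \<in> orbit_closure p"
proof (induction n rule: less_induct)
  case (less n)
  define \<alpha> where "\<alpha> N = real (Suc N) * (1 / (4 * p))" for N
  have \<alpha>: "0 < \<alpha> N" "1 / (4 * p) \<le> \<alpha> N" for N using p by (auto simp: \<alpha>_def field_simps)
  define h where "h N x = (kern (\<lambda>t. t powr \<alpha> N) x - (\<Sum>k<n. beta_moment (\<alpha> N) k * x ^ k)) / beta_moment (\<alpha> N) n" for N x
  have err: "\<bar>h N x - x ^ n\<bar> \<le> (real n + 1) / \<alpha> N" if "0 < x" "x < 1" for N x
    unfolding h_def using that \<alpha> by (intro kern_powr_expansion)
  have hmem: "(\<lambda>x. complex_of_real (h N x)) \<in> orbit_closure p" for N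
  proof -
    have "(\<lambda>x. of_real (kern (\<lambda>t. t powr \<alpha> N) x)) \<in> orbit_closure p"
    proof (rule orbit_closure_cong[OF p kern_powr_log_power_mem[OF p, of "Suc N" 0]])
      fix x
      show "complex_of_real (kern (\<lambda>t. t powr (real (Suc N) * (1 / (4 * p))) * (- ln t) ^ 0) x) =
        of_real (kern (\<lambda>t. t powr \<alpha> N) x)"
        by (simp add: \<alpha>_def)
    qed
    then have "(\<lambda>x. of_real (1 / beta_moment (\<alpha> N) n) * (of_real (kern (\<lambda>t. t powr \<alpha> N) x) +
        (\<Sum>k<n. of_real (- beta_moment (\<alpha> N) k) * of_real x ^ k))) \<in> orbit_closure p"
      by (intro orbit_closure_scale orbit_closure_add orbit_closure_sum p less) auto
    then show ?thesis
      by (rule orbit_closure_cong[OF p]) (simp add: h_def sum_negf)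
  qed
  show ?case
  proof (rule orbit_closure_bounded_limit[OF p hmem, where B = "1 + (real n + 1) / (1 / (4 * p))"])
    fix N and x :: real assume x: "0 < x" "x < 1"
    have "(real n + 1) / \<alpha> N \<le> (real n + 1) / (1 / (4 * p))"
      using \<alpha>[of N] p by (intro divide_left_mono) auto
    moreover have "0 \<le> x ^ n" "x ^ n \<le> 1" using x by (auto simp: power_le_one)
    ultimately have "\<bar>h N x\<bar> \<le> 1 + (real n + 1) / (1 / (4 * p))" using err[OF x, of N] by linarith
    then show "cmod (complex_of_real (h N x)) \<le> 1 + (real n + 1) / (1 / (4 * p))" by simp
  next
    have lim: "(\<lambda>N. h N x) \<longlonglongrightarrow> x ^ n" if x: "0 < x" "x < 1" for x
    proof -
      have "(\<lambda>N. (real n + 1) * (4 * p) * inverse (real (Suc N))) \<longlonglongrightarrow> (real n + 1) * (4 * p) * 0"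
        by (intro tendsto_mult_left LIMSEQ_inverse_real_of_nat)
      moreover have "(real n + 1) / \<alpha> N = (real n + 1) * (4 * p) * inverse (real (Suc N))" for N
        by (simp add: \<alpha>_def field_simps)
      ultimately have "(\<lambda>N. (real n + 1) / \<alpha> N) \<longlonglongrightarrow> 0"
        by simp
      then have "(\<lambda>N. h N x - x ^ n) \<longlonglongrightarrow> 0"
        by (rule Lim_null_comparison[rotated]) (use err[OF x] in auto)
      then show ?thesis by (simp add: LIM_zero_iff)
    qed
    show "AE x in unit_leb. (\<lambda>N. complex_of_real (h N x)) \<longlonglongrightarrow> of_real x ^ n"
      using tendsto_of_real[OF lim] by (intro AE_unit_leb_I) simp
    have "(\<lambda>x. complex_of_real (x ^ n)) \<in> borel_measurable unit_leb"
      by (intro borel_measurable_unit_leb_of_real) measurable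
    then show "(\<lambda>x. complex_of_real x ^ n) \<in> borel_measurable unit_leb" by simp
  qed
qed

section \<open>Density in \<open>L\<^sup>p\<close>\<close>

lemma real_continuous_mem_orbit_closure:
  fixes f :: "real \<Rightarrow> real"
  assumes p: "1 < p" and f: "continuous_on UNIV f"
  shows "(\<lambda>x. of_real (f x)) \<in> orbit_closure p"
proof -
  have f01: "continuous_on {0..1} f" using f continuous_on_subset by blast
  have "\<exists>g. real_polynomial_function g \<and> (\<forall>x\<in>{0..1}. \<bar>f x - g x\<bar> < 1 / real (Suc N))" for N
    using Stone_Weierstrass_real_polynomial_function[OF compact_Icc f01, of "1 / real (Suc N)"]
    by (metis zero_less_divide_1_iff of_nat_0_less_iff zero_less_Suc)
  then obtain g where g: "\<And>N. real_polynomial_function (g N)"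
    "\<And>N x. x \<in> {0..1} \<Longrightarrow> \<bar>f x - g N x\<bar> < 1 / real (Suc N)"
    by metis
  have gmem: "(\<lambda>x. complex_of_real (g N x)) \<in> orbit_closure p" for N
  proof -
    obtain a n where a: "g N = (\<lambda>x. \<Sum>i\<le>n. a i * x ^ i)"
      using g(1)[of N] unfolding real_polynomial_function_iff_sum by blast
    have "(\<lambda>x. \<Sum>i\<le>n. of_real (a i) * of_real x ^ i) \<in> orbit_closure p"
      by (intro orbit_closure_sum orbit_closure_scale monomial_mem_orbit_closure p) auto
    then show ?thesis by (simp add: a)
  qed
  obtain K where K: "\<And>x. x \<in> {0..1} \<Longrightarrow> \<bar>f x\<bar> \<le> K"
    using compact_imp_bounded[OF compact_continuous_image[OF f01 compact_Icc]]
    unfolding bounded_iff by (metis imageI real_norm_def)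
  show ?thesis
  proof (rule orbit_closure_bounded_limit[OF p gmem, where B = "K + 1"])
    fix N and x :: real assume x: "0 < x" "x < 1"
    have "1 / real (Suc N) \<le> 1" by simp
    moreover have "\<bar>f x - g N x\<bar> < 1 / real (Suc N)" "\<bar>f x\<bar> \<le> K" using g(2) K x by auto
    ultimately have "\<bar>g N x\<bar> \<le> K + 1" by linarith
    then show "cmod (complex_of_real (g N x)) \<le> K + 1" by simp
  next
    have lim: "(\<lambda>N. g N x) \<longlonglongrightarrow> f x" if x: "0 < x" "x < 1" for x
    proof -
      have "(\<lambda>N. g N x - f x) \<longlonglongrightarrow> 0"
        by (rule Lim_null_comparison[OF _ LIMSEQ_inverse_real_of_nat])
           (use g(2)[of x] x in \<open>auto simp: abs_minus_commute inverse_eq_divide intro!: always_eventually less_imp_le\<close>)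
      then show ?thesis by (simp add: LIM_zero_iff)
    qed
    show "AE x in unit_leb. (\<lambda>N. complex_of_real (g N x)) \<longlonglongrightarrow> of_real (f x)"
      by (intro AE_unit_leb_I tendsto_of_real lim)
    show "(\<lambda>x. complex_of_real (f x)) \<in> borel_measurable unit_leb"
      using f by (intro borel_measurable_unit_leb_of_real borel_measurable_continuous_onI)
  qed
qed

lemma continuous_mem_orbit_closure:
  assumes p: "1 < p" and f: "continuous_on UNIV f"
  shows "f \<in> orbit_closure p"
proof -
  have "(\<lambda>x. of_real (Re (f x)) + \<i> * of_real (Im (f x))) \<in> orbit_closure p"
    using f by (intro orbit_closure_add orbit_closure_scale real_continuous_mem_orbit_closure p continuous_intros)
  also have "(\<lambda>x. of_real (Re (f x)) + \<i> * of_real (Im (f x))) = f"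
    by (rule ext) (rule complex_eq[symmetric])
  finally show ?thesis .
qed

text \<open>
  A measurable function is an almost everywhere limit of continuous ones. Clipping these to the
  disc of radius \<open>K\<close> leaves them continuous and makes \<open>K\<close> a dominator.
\<close>

lemma bounded_measurable_mem_orbit_closure:
  assumes p: "1 < p" and f: "f \<in> borel_measurable unit_leb"
    and bound: "\<And>x. 0 < x \<Longrightarrow> x < 1 \<Longrightarrow> norm (f x) \<le> K"
  shows "f \<in> orbit_closure p"
proof -
  have "f measurable_on {0<..<1}"
    using f by (simp add: measurable_on_iff_borel_measurable)
  then obtain N g where N: "negligible N" and g: "\<And>n. continuous_on UNIV (g n)"
    and lim: "\<And>x. x \<notin> N \<Longrightarrow> (\<lambda>n. g n x) \<longlonglongrightarrow> (if x \<in> {0<..<1} then f x else 0)"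
    unfolding measurable_on_def by blast
  define clip where "clip z = closest_point (cball 0 K) z" for z :: complex
  have K: "0 \<le> K" using bound[of "1/2"] norm_ge_zero[of "f (1/2)"] by linarith
  have clip: "continuous_on UNIV clip" "norm (clip z) \<le> K" "norm z \<le> K \<Longrightarrow> clip z = z" for z
    unfolding clip_def using K closest_point_in_set[of "cball 0 K" z]
    by (auto intro: continuous_on_closest_point closest_point_self)
  show ?thesis
  proof (rule orbit_closure_bounded_limit[OF p, where f = "\<lambda>n x. clip (g n x)" and B = K])
    show "(\<lambda>x. clip (g n x)) \<in> orbit_closure p" for n
      using continuous_on_compose[OF g[of n], of clip] clip(1) continuous_on_subset
      by (intro continuous_mem_orbit_closure p) (auto simp: o_def)
    have "AE x in lebesgue. x \<notin> N"
      using N by (simp add: negligible_iff_null_sets AE_not_in)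
    then have "AE x in unit_leb. x \<notin> N"
      by (auto simp: AE_restrict_space_iff elim: eventually_mono)
    moreover have "AE x in unit_leb. x \<in> {0<..<1}" by (rule AE_unit_leb_I) auto
    ultimately show "AE x in unit_leb. (\<lambda>n. clip (g n x)) \<longlonglongrightarrow> f x"
    proof eventually_elim
      case (elim x)
      then have "(\<lambda>n. clip (g n x)) \<longlonglongrightarrow> clip (f x)"
        using lim[of x] clip(1) by (intro continuous_on_tendsto_compose[OF clip(1)]) auto
      then show ?case using elim bound[of x] by (simp add: clip(3))
    qed
  qed (use clip f in auto)
qed

lemma orbit_closure_eq_Lp:
  assumes p: "1 < p"
  shows "orbit_closure p = Lp p"
proof
  show "orbit_closure p \<subseteq> Lp p" by (auto simp: orbit_closure_def Lp_closure_def)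
  show "Lp p \<subseteq> orbit_closure p"
  proof
    fix f assume f: "f \<in> Lp p"
    have [measurable]: "f \<in> borel_measurable unit_leb" using f by (simp add: Lp_def)
    define g where "g n x = (if norm (f x) \<le> real n then f x else 0)" for n x
    have [measurable]: "g n \<in> borel_measurable unit_leb" for n unfolding g_def by measurable
    have gmem: "g n \<in> orbit_closure p" for n
      by (rule bounded_measurable_mem_orbit_closure[OF p, where K = "real n"]) (auto simp: g_def)
    have "(\<lambda>n. g n x) \<longlonglongrightarrow> f x" for x
    proof (rule tendsto_eventually)
      obtain k where "norm (f x) \<le> real k" using real_arch_simple by blast
      then show "\<forall>\<^sub>F n in sequentially. g n x = f x"
        by (intro eventually_sequentiallyI[of k]) (auto simp: g_def)
    qed
    then have lim: "AE x in unit_leb. (\<lambda>n. g n x) \<longlonglongrightarrow> f x" by simp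
    show "f \<in> orbit_closure p"
      unfolding orbit_closure_def
    proof (rule Lp_closure_dominated_limit[OF _ gmem[unfolded orbit_closure_def] _ _ lim])
      show "integrable unit_leb (\<lambda>x. norm (f x) powr p)" using f by (simp add: Lp_def)
      show "AE x in unit_leb. norm (g n x) \<le> norm (f x)" for n by (simp add: g_def)
    qed (use p in auto)
  qed
qed

theorem theorem7p1:
  fixes p :: real
  assumes "1 < p"
  shows "cyclic_vector p C_op (\<lambda>_. 1)"
  unfolding cyclic_vector_def
proof (intro conjI allI)
  show "(\<lambda>_. 1) \<in> Lp p" using funpow_C_op_one_in_Lp[OF assms, of 0] by simp
  show "(C_op ^^ n) (\<lambda>_. 1) \<in> Lp p" for n by (rule funpow_C_op_one_in_Lp[OF assms])
  show "Lp_closure p (cfun.span {(C_op ^^ n) (\<lambda>_. 1) | n. True}) = Lp p"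
    using orbit_closure_eq_Lp[OF assms] unfolding orbit_closure_def .
qed

end
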